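(* Let $p>1$. Suppose the Drift Assumption, the Unbiased Noise Assumption, the $p$-th Moment Noise Assumption (with this $p$) and the Lipschitz Assumption (all described in the context) hold for the stochastic approximation iteration $x_{k+1}=x_k+\alpha_k\big(H(x_k)-x_k+w_k\big)$. Let $(\alpha_k)_{k\ge 0}$ be a non-increasing sequence of positive step sizes with $$\sum_{k=0}^\infty \alpha_k=\infty,\qquad \sum_{k=0}^\infty \alpha_k^{p}<\infty .$$ Then $x^\star$ is the unique solution of $H(x)=x$, and $x_k\to x^\star$ almost surely.
   Context: Let $\|\cdot\|$ denote the Euclidean norm on $\mathbb{R}^d$ and $\langle\cdot,\cdot\rangle$ the Euclidean inner product. Let $H:\mathbb{R}^d\to\mathbb{R}^d$ and consider the stochastic approximation iteration $x_{k+1}=x_k+\alpha_k\big(H(x_k)-x_k+w_k\big)$, $k\ge 0$, where $x_0$ is an initial point, $(\alpha_k)_{k\ge0}$ are positive step sizes and $(w_k)_{k\ge0}$ are random vectors in $\mathbb{R}^d$ defined on a common probability space. Let $\mathcal F_k=\sigma(x_0,x_1,\dots,x_k)$. Drift Assumption: there is $x^\star\in\mathbb{R}^d$ with $H(x^\star)=x^\star$, a differentiable function $\Phi:\mathbb{R}^d\to[0,\infty)$ and constants $\eta,c_1,c_2,L_2>0$ such that (i) $\langle\nabla\Phi(x-x^\star),H(x)-x\rangle\le-\eta\,\Phi(x-x^\star)$ for all $x\in\mathbb{R}^d$; (ii) $\Phi(y)\le\Phi(x)+\langle\nabla\Phi(x),y-x\rangle+\frac{L_2}{2}\|y-x\|^2$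 for all $x,y\in\mathbb{R}^d$; (iii) $c_1\|x-x^\star\|^2\le\Phi(x-x^\star)\le c_2\|x-x^\star\|^2$ for all $x\in\mathbb{R}^d$. Unbiased Noise Assumption: each $w_k$ is integrable and $\mathbb{E}[w_k\mid\mathcal F_k]=0$ almost surely for all $k\ge0$. $p$-th Moment Noise Assumption (for a given $p>1$): there are constants $A_p>0$, $B_p\ge0$ such that $\mathbb{E}[\|w_k\|^p\mid\mathcal F_k]\le A_p+B_p\|x_k-x^\star\|^p$ almost surely for all $k\ge 0$. Lipschitz Assumption: there is $C>0$ with $\|H(x)-H(y)\|\le C\|x-y\|$ for all $x,y\in\mathbb{R}^d$. *)

theory Defs
  imports "HOL-Analysis.Analysis" "HOL-Probability.Probability"
begin

definition natural_filtration ::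
  "'a measure \<Rightarrow> (nat \<Rightarrow> 'a \<Rightarrow> 'b::topological_space) \<Rightarrow> nat \<Rightarrow> 'a measure" where
  "natural_filtration M X k =
     sigma (space M) (\<Union>i\<in>{..k}. {X i -` A \<inter> space M | A. A \<in> sets borel})"

end

theory Submission
  imports Defs
begin

text \<open>The proof uses the Lyapunov function \<open>f = ln (1 + \<Phi>^m)\<close> with an integer \<open>m \<ge> p\<close>. Near the
solution it is of order \<open>2m\<close> in the distance, so that the second-order error \<open>\<alpha>\<^sup>2 \<Phi>^(m-1)\<close> is absorbed by the drift
\<open>\<alpha> \<Phi>^m\<close> up to \<open>\<alpha>^(m+1)\<close>, hence up to the summable \<open>\<alpha>^p\<close>, even where \<open>p > 2\<close> and \<open>\<alpha>\<^sup>2\<close> is not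
summable. At infinity it is logarithmic, so that a large jump costs only its \<open>p\<close>-th moment, and its
gradient is bounded, so that the noise term is integrable. Thus
\<open>E[f(k+1) | F k] \<le> f k - c \<alpha> k \<tau> k + K (\<alpha> k)^p\<close> with \<open>\<tau> = \<Phi>^m / (1 + \<Phi>^m) = 1 - exp (- f)\<close>.
Since the step sizes are not summable, \<open>E \<tau> k\<close> is arbitrarily small for suitable large \<open>k\<close>; from such
a time on, a maximal inequality on the event that \<open>f k\<close> is small keeps \<open>f\<close> small forever.\<close>

section \<open>Almost supermartingales\<close>

text \<open>For p < 2 the noise may have no second moment, so a quadratic remainder cannot simply be
  integrated. The remedy is the relative step length q = \<alpha> \<xi>, where \<xi> bounds the
  random direction in units of 1 + n and n is the distance from the solution. For q \<le> 1 a
  Taylor-type bound applies and surplus powers of q are lowered to q^p; for q > 1 the logarithm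
  grows so slowly that q^p pays for everything. Measuring in units of 1 + n also turns the growing
  moment bound A + B n^p into the constant A + B, so that first moments of the iterates suffice. The
  almost supermartingale property is kept in integrated form, over events of \<open>F k\<close>,
  which is exactly what the maximal inequality consumes. Writing the drift as
  \<open>1 - exp (- f)\<close> lets the probabilistic part speak of \<open>f\<close> alone. Since
  the mean of \<open>f k\<close> itself is not known to become small, only this bounded function of
  it, the process has to be restarted on an event and not on the whole space.\<close>

lemma (in prob_space) maximal_inequality_almost_supermartingale:
  fixes f :: "nat \<Rightarrow> 'a \<Rightarrow> real" and b :: "nat \<Rightarrow> real" and F :: "nat \<Rightarrow> 'a measure"
  assumes sub: "\<And>k. subalgebra M (F k)"
    and mono: "\<And>k. sets (F k) \<subseteq> sets (F (Suc k))"
    and meas: "\<And>k. f k \<in> borel_measurable (F k)"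
    and int: "\<And>k. integrable M (f k)"
    and nonneg: "\<And>k \<omega>. f k \<omega> \<ge> 0"
    and step: "\<And>k A. A \<in> sets (F k) \<Longrightarrow> (\<integral>\<omega>. indicator A \<omega> * f (Suc k) \<omega> \<partial>M) \<le> (\<integral>\<omega>. indicator A \<omega> * f k \<omega> \<partial>M) + b k"
    and A: "A \<in> sets (F n)" and l: "l > 0"
  shows "l * prob {\<omega>\<in>A. \<exists>k\<in>{n..n+r}. f k \<omega> \<ge> l} \<le> (\<integral>\<omega>. indicator A \<omega> * f n \<omega> \<partial>M) + (\<Sum>k<r. b (n + k))"
proof -
  have space: "space (F k) = space M" for k using sub by (auto simp: subalgebra_def)
  have setsM: "B \<in> sets M" if "B \<in> sets (F k)" for B k
    using sub that by (auto simp: subalgebra_def)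
  have mono': "sets (F i) \<subseteq> sets (F k)" if "i \<le> k" for i k
    using that by (induction rule: dec_induct) (use mono in auto)
  have ge: "{\<omega>\<in>space M. f i \<omega> \<ge> l} \<in> sets (F k)" if "i \<le> k" for i k
    using borel_measurable_le[OF borel_measurable_const meas, of i l] mono'[OF that] by (auto simp: space)
  have integ: "integrable M (\<lambda>\<omega>. indicator B \<omega> * f k \<omega>)" if "B \<in> sets M" for B k
    using integrable_mult_indicator[OF that int[of k]] by simp
  \<comment> \<open>\<open>T r\<close> is the part of \<open>A\<close> on which level l has been
    reached by time n + r, \<open>S r\<close> the part on which it has not. The invariant proved by
    induction replaces a stopping time: mass that has hit counts with the value l, the rest with the
    current value of \<open>f\<close>.\<close>
  define S where "S r = A - (\<Union>k\<in>{n..n+r}. {\<omega>\<in>space M. f k \<omega> \<ge> l})" for r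
  define T where "T r = A \<inter> (\<Union>k\<in>{n..n+r}. {\<omega>\<in>space M. f k \<omega> \<ge> l})" for r
  have AF: "A \<in> sets (F (n + r))" for r using mono'[of n "n + r"] A by auto
  have U: "(\<Union>k\<in>{n..n+r}. {\<omega>\<in>space M. f k \<omega> \<ge> l}) \<in> sets (F (n + r))" for r
    by (intro sets.finite_UN) (auto intro!: ge)
  have SF: "S r \<in> sets (F (n + r))" and TF: "T r \<in> sets (F (n + r))" for r
    using AF U by (auto simp: S_def T_def)
  have SM: "S r \<in> sets M" and TM: "T r \<in> sets M" for r using SF TF setsM by blast+
  \<comment> \<open>Markov's inequality on the part B that hits now, while the integral over the
    rest of D is kept.\<close>
  have split: "l * prob B + (\<integral>\<omega>. indicator (D - B) \<omega> * f k \<omega> \<partial>M) \<le> (\<integral>\<omega>. indicator D \<omega> * f k \<omega> \<partial>M)"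
    if "B \<subseteq> D" "B \<in> sets M" "D \<in> sets M" "\<And>\<omega>. \<omega> \<in> B \<Longrightarrow> f k \<omega> \<ge> l" for B D k
  proof -
    have "l * prob B + (\<integral>\<omega>. indicator (D - B) \<omega> * f k \<omega> \<partial>M) = (\<integral>\<omega>. l * indicator B \<omega> + indicator (D - B) \<omega> * f k \<omega> \<partial>M)"
      using that by (subst Bochner_Integration.integral_add) (auto intro!: integ simp: less_top[symmetric])
    also have "\<dots> \<le> (\<integral>\<omega>. indicator D \<omega> * f k \<omega> \<partial>M)"
      using that by (intro integral_mono Bochner_Integration.integrable_add integ)
        (auto simp: less_top[symmetric] split: split_indicator)
    finally show ?thesis .
  qed
  have "l * prob (T r) + (\<integral>\<omega>. indicator (S r) \<omega> * f (n + r) \<omega> \<partial>M) \<le> (\<integral>\<omega>. indicator A \<omega> * f n \<omega> \<partial>M) + (\<Sum>k<r. b (n + k))" for r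
  proof (induction r)
    case 0
    have "S 0 = A - T 0" by (auto simp: S_def T_def)
    moreover have "l * prob (T 0) + (\<integral>\<omega>. indicator (A - T 0) \<omega> * f n \<omega> \<partial>M) \<le> (\<integral>\<omega>. indicator A \<omega> * f n \<omega> \<partial>M)"
      by (rule split[of "T 0" A n]) (use setsM[OF A] TM[of 0] in \<open>auto simp: T_def\<close>)
    ultimately show ?case by simp
  next
    case (Suc r)
    define B where "B = S r \<inter> {\<omega>\<in>space M. f (Suc (n + r)) \<omega> \<ge> l}"
    have iv: "{n..n + Suc r} = insert (Suc (n + r)) {n..n+r}" by auto
    have BM: "B \<in> sets M"
      unfolding B_def using SM[of r] setsM[OF ge[OF order_refl, of "Suc (n + r)"]] by auto
    have TS: "T (Suc r) = T r \<union> B" "T r \<inter> B = {}" and SS: "S (Suc r) = S r - B"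
      unfolding T_def S_def B_def iv UN_insert by blast+
    have "prob (T (Suc r)) = prob (T r) + prob B"
      unfolding TS(1) using TM BM TS(2) by (intro finite_measure_Union)
    moreover have "l * prob B + (\<integral>\<omega>. indicator (S r - B) \<omega> * f (Suc (n + r)) \<omega> \<partial>M) \<le> (\<integral>\<omega>. indicator (S r) \<omega> * f (Suc (n + r)) \<omega> \<partial>M)"
      by (rule split[of B "S r" "Suc (n + r)"]) (use BM SM[of r] in \<open>auto simp: B_def\<close>)
    moreover note step[OF SF, of r]
    ultimately show ?case using Suc by (simp add: SS distrib_left)
  qed
  from this[of r] have "l * prob (T r) + (\<integral>\<omega>. indicator (S r) \<omega> * f (n + r) \<omega> \<partial>M) \<le> (\<integral>\<omega>. indicator A \<omega> * f n \<omega> \<partial>M) + (\<Sum>k<r. b (n + k))" .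
  moreover have "T r = {\<omega>\<in>A. \<exists>k\<in>{n..n+r}. f k \<omega> \<ge> l}"
    using sets.sets_into_space[OF setsM[OF A]] by (auto simp: T_def)
  moreover have "(\<integral>\<omega>. indicator (S r) \<omega> * f (n + r) \<omega> \<partial>M) \<ge> 0"
    by (intro integral_nonneg_AE) (auto simp: nonneg)
  ultimately show ?thesis by simp
qed

text \<open>Were \<open>t\<close> at least e from N on, the divergent series of
  \<open>\<alpha>\<close> would be dominated by a convergent one. With means for \<open>t\<close>
  this supplies arbitrarily late times at which a process can be restarted.\<close>

lemma sum_prod_finite_imp_small:
  fixes \<alpha> t :: "nat \<Rightarrow> real"
  assumes \<alpha>: "\<And>k. \<alpha> k > 0" and ns: "\<not> summable \<alpha>" and t: "\<And>k. t k \<ge> 0"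
    and bd: "\<And>n. (\<Sum>k<n. \<alpha> k * t k) \<le> B" and e: "e > 0"
  shows "\<exists>n\<ge>N. t n < e"
proof (rule ccontr)
  assume "\<not> ?thesis"
  then have h: "t n \<ge> e" if "n \<ge> N" for n using that by force
  have "summable (\<lambda>k. \<alpha> k * t k)"
  proof (rule bounded_imp_summable)
    show "(\<Sum>k\<le>n. \<alpha> k * t k) \<le> B" for n
      using bd[of "Suc n"] by (simp add: lessThan_Suc_atMost)
  qed (use \<alpha> t in \<open>simp add: less_imp_le\<close>)
  then have "summable (\<lambda>k. inverse e * (\<alpha> k * t k))" by (rule summable_mult)
  moreover have "norm (\<alpha> k) \<le> inverse e * (\<alpha> k * t k)" if "k \<ge> N" for k
    using h[OF that] \<alpha>[of k] e by (simp add: field_simps)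
  ultimately have "summable \<alpha>" by (rule summable_comparison_test'[of _ N])
  with ns show False by simp
qed

text \<open>The accumulated drift is finite, so \<open>1 - exp (- f k)\<close> has small mean at
  some late k. This function increases with \<open>f k\<close> from the value 0, hence
  \<open>f k\<close> is then small with high probability. Restarted there, with only a small tail of
  \<open>b\<close> left, the process rarely reaches a given level again.\<close>

lemma (in prob_space) almost_supermartingale_tendsto_zero:
  fixes f :: "nat \<Rightarrow> 'a \<Rightarrow> real" and \<alpha> b :: "nat \<Rightarrow> real" and F :: "nat \<Rightarrow> 'a measure"
  assumes sub: "\<And>k. subalgebra M (F k)"
    and mono: "\<And>k. sets (F k) \<subseteq> sets (F (Suc k))"
    and meas: "\<And>k. f k \<in> borel_measurable (F k)"
    and int: "\<And>k. integrable M (f k)"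
    and nonneg: "\<And>k \<omega>. f k \<omega> \<ge> 0"
    and \<alpha>: "\<And>k. \<alpha> k > 0" "\<not> summable \<alpha>"
    and b: "\<And>k. b k \<ge> 0" "summable b"
    and step: "\<And>k A. A \<in> sets (F k) \<Longrightarrow> (\<integral>\<omega>. indicator A \<omega> * f (Suc k) \<omega> \<partial>M)
        \<le> (\<integral>\<omega>. indicator A \<omega> * f k \<omega> \<partial>M) - \<alpha> k * (\<integral>\<omega>. indicator A \<omega> * (1 - exp (- f k \<omega>)) \<partial>M) + b k"
  shows "AE \<omega> in M. (\<lambda>k. f k \<omega>) \<longlonglongrightarrow> 0"
proof -
  have space: "space (F k) = space M" for k using sub by (auto simp: subalgebra_def)
  have [measurable]: "f k \<in> borel_measurable M" for k using int[of k] by measurable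
  have tint: "integrable M (\<lambda>\<omega>. 1 - exp (- f k \<omega>))" for k
    by (rule integrable_const_bound[of _ 1]) (auto simp: nonneg)
  define t where "t k = (\<integral>\<omega>. 1 - exp (- f k \<omega>) \<partial>M)" for k
  have t0: "t k \<ge> 0" for k unfolding t_def by (intro integral_nonneg_AE) (auto simp: nonneg)
  have top: "space M \<in> sets (F k)" for k using sets.top[of "F k"] by (simp add: space)
  have [simp]: "(\<integral>\<omega>. indicator (space M) \<omega> * g \<omega> \<partial>M) = (\<integral>\<omega>. g \<omega> \<partial>M)" for g :: "'a \<Rightarrow> real"
    by (intro Bochner_Integration.integral_cong) auto
  have "(\<integral>\<omega>. f n \<omega> \<partial>M) + (\<Sum>k<n. \<alpha> k * t k) \<le> (\<integral>\<omega>. f 0 \<omega> \<partial>M) + (\<Sum>k<n. b k)" for n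
  proof (induction n)
    case (Suc n)
    then show ?case using step[OF top, of n] by (simp add: t_def)
  qed simp
  moreover have "(\<integral>\<omega>. f n \<omega> \<partial>M) \<ge> 0" for n by (intro integral_nonneg_AE) (auto simp: nonneg)
  moreover have "(\<Sum>k<n. b k) \<le> suminf b" for n using b by (intro sum_le_suminf) auto
  ultimately have bd: "(\<Sum>k<n. \<alpha> k * t k) \<le> (\<integral>\<omega>. f 0 \<omega> \<partial>M) + suminf b" for n
  proof -
    assume *: "\<And>n. (\<integral>\<omega>. f n \<omega> \<partial>M) + (\<Sum>k<n. \<alpha> k * t k) \<le> (\<integral>\<omega>. f 0 \<omega> \<partial>M) + (\<Sum>k<n. b k)"
      "\<And>n. (\<integral>\<omega>. f n \<omega> \<partial>M) \<ge> 0" "\<And>n. (\<Sum>k<n. b k) \<le> suminf b"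
    show ?thesis using *(1)[of n] *(2)[of n] *(3)[of n] by linarith
  qed
  note small = sum_prod_finite_imp_small[OF \<alpha> t0 bd]
  have step': "(\<integral>\<omega>. indicator A \<omega> * f (Suc k) \<omega> \<partial>M) \<le> (\<integral>\<omega>. indicator A \<omega> * f k \<omega> \<partial>M) + b k"
    if "A \<in> sets (F k)" for A k
  proof -
    have "(\<integral>\<omega>. indicator A \<omega> * (1 - exp (- f k \<omega>)) \<partial>M) \<ge> 0"
      by (intro integral_nonneg_AE) (auto simp: nonneg)
    then have "\<alpha> k * (\<integral>\<omega>. indicator A \<omega> * (1 - exp (- f k \<omega>)) \<partial>M) \<ge> 0" using \<alpha>(1)[of k] by simp
    then show ?thesis using step[OF that] by linarith
  qed
  have main: "AE \<omega> in M. eventually (\<lambda>k. f k \<omega> < l) sequentially" if l: "l > 0" for l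
  proof -
    \<comment> \<open>\<open>Z\<close> is the event of infinitely many visits above l; it is null
      once its probability is below every e > 0.\<close>
    define Z where "Z = {\<omega>\<in>space M. \<forall>n. \<exists>k\<ge>n. f k \<omega> \<ge> l}"
    have [measurable]: "Z \<in> sets M" unfolding Z_def by measurable
    have "prob Z \<le> e" if e: "e > 0" for e
    proof -
      \<comment> \<open>The budget e is split into thirds. The value at time n and the tail of
        \<open>b\<close> each contribute at most \<delta> to the maximal inequality, hence e / 3 to
        the probability after division by l; the last third pays for the complement of
        \<open>A\<close>. The number \<delta>' is the value of 1 - exp (- f) at f = \<delta>, which
        converts a small \<open>t n\<close> into a bound for the event f n > \<delta>.\<close>
      define \<delta> where "\<delta> = l * e / 3"
      define \<delta>' where "\<delta>' = 1 - exp (- \<delta>)"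
      have \<delta>: "\<delta> > 0" "\<delta>' > 0" using l e by (auto simp: \<delta>_def \<delta>'_def)
      obtain N where N: "\<And>n. n \<ge> N \<Longrightarrow> norm (\<Sum>k. b (k + n)) < \<delta>"
        using suminf_exist_split[OF \<delta>(1) b(2)] by blast
      obtain n where n: "n \<ge> N" "t n < \<delta>' * e / 3" using small[of "\<delta>' * e / 3" N] \<delta> e by auto
      define A where "A = {\<omega>\<in>space M. f n \<omega> \<le> \<delta>}"
      have AF: "A \<in> sets (F n)"
        using borel_measurable_le[OF meas borel_measurable_const, of n \<delta>] by (simp add: A_def space)
      have AM[measurable]: "A \<in> sets M" unfolding A_def by measurable
      have tail: "(\<Sum>k<r. b (n + k)) \<le> \<delta>" for r
      proof -
        have "(\<Sum>k<r. b (n + k)) \<le> (\<Sum>k. b (n + k))"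
          using b summable_iff_shift[of b n] by (intro sum_le_suminf) (auto simp: add.commute)
        then show ?thesis using N[OF n(1)] by (simp add: add.commute)
      qed
      have "(\<integral>\<omega>. indicator A \<omega> * f n \<omega> \<partial>M) \<le> (\<integral>\<omega>. \<delta> \<partial>M)"
        using integrable_mult_indicator[OF AM int[of n]] \<delta>
        by (intro integral_mono) (auto simp: A_def split: split_indicator)
      then have fA: "(\<integral>\<omega>. indicator A \<omega> * f n \<omega> \<partial>M) \<le> \<delta>" by (simp add: prob_space)
      define T where "T r = {\<omega>\<in>A. \<exists>k\<in>{n..n+r}. f k \<omega> \<ge> l}" for r
      have TM: "T r \<in> sets M" for r
      proof -
        have "T r = A \<inter> {\<omega>\<in>space M. \<exists>k\<in>{n..n+r}. f k \<omega> \<ge> l}" by (auto simp: T_def A_def)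
        then show ?thesis by simp
      qed
      have Tb: "prob (T r) \<le> 2 * e / 3" for r
      proof -
        have "l * prob (T r) \<le> \<delta> + \<delta>"
          using maximal_inequality_almost_supermartingale[OF sub mono meas int nonneg step' AF l, of r] tail[of r] fA
          by (simp add: T_def)
        then show ?thesis using l by (simp add: \<delta>_def field_simps)
      qed
      \<comment> \<open>The bound does not depend on the horizon r, so continuity from below extends
        it to all later times.\<close>
      have "(\<lambda>r. prob (T r)) \<longlonglongrightarrow> prob (\<Union>r. T r)"
        by (rule finite_Lim_measure_incseq) (use TM in \<open>auto simp: incseq_def T_def\<close>)
      then have TU: "prob (\<Union>r. T r) \<le> 2 * e / 3" by (rule LIMSEQ_le_const2) (use Tb in auto)
      have "\<delta>' * prob (space M - A) = (\<integral>\<omega>. \<delta>' * indicator (space M - A) \<omega> \<partial>M)" by simp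
      also have "\<dots> \<le> t n" unfolding t_def
        using \<delta> by (intro integral_mono tint) (auto simp: A_def \<delta>'_def nonneg less_top[symmetric] split: split_indicator)
      finally have "\<delta>' * prob (space M - A) \<le> \<delta>' * (e / 3)" using n by simp
      then have Ac: "prob (space M - A) \<le> e / 3" using \<delta> by simp
      have "Z \<subseteq> (\<Union>r. T r) \<union> (space M - A)"
      proof
        fix \<omega> assume z: "\<omega> \<in> Z"
        then obtain k where "k \<ge> n" "f k \<omega> \<ge> l" by (auto simp: Z_def)
        moreover from \<open>k \<ge> n\<close> obtain r where "k = n + r" using le_Suc_ex by blast
        ultimately have "\<omega> \<in> T r" if "\<omega> \<in> A" using that by (auto simp: T_def)
        then show "\<omega> \<in> (\<Union>r. T r) \<union> (space M - A)" using z by (auto simp: Z_def)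
      qed
      then have "prob Z \<le> prob ((\<Union>r. T r) \<union> (space M - A))"
        using TM by (intro finite_measure_mono) auto
      also have "\<dots> \<le> prob (\<Union>r. T r) + prob (space M - A)"
        using TM by (intro measure_Un_le) auto
      finally show ?thesis using TU Ac by simp
    qed
    then have "prob Z \<le> 0" by (rule field_le_epsilon[of _ 0, unfolded add_0])
    then have "prob Z = 0" by (simp add: measure_le_0_iff)
    then have "AE \<omega> in M. \<omega> \<notin> Z" by (intro AE_not_in) (auto simp: null_sets_def emeasure_eq_measure)
    then show ?thesis
      by (rule AE_mp) (intro AE_I2 impI, simp add: Z_def eventually_sequentially, metis not_le)
  qed
  have "AE \<omega> in M. \<forall>i::nat. eventually (\<lambda>k. f k \<omega> < inverse (Suc i)) sequentially"
    unfolding AE_all_countable by (auto intro!: main)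
  then show ?thesis
  proof (rule AE_mp, intro AE_I2 impI)
    fix \<omega> assume h: "\<forall>i::nat. eventually (\<lambda>k. f k \<omega> < inverse (Suc i)) sequentially"
    show "(\<lambda>k. f k \<omega>) \<longlonglongrightarrow> 0"
    proof (rule order_tendstoI)
      fix a :: real assume "0 < a"
      then obtain i where "inverse (real (Suc i)) < a" using reals_Archimedean by blast
      then show "eventually (\<lambda>k. f k \<omega> < a) sequentially"
        by (intro eventually_mono[OF h[rule_format, of i]]) simp
    qed (auto intro!: always_eventually less_le_trans[OF _ nonneg])
  qed
qed

section \<open>Increments of the Lyapunov function\<close>

text \<open>Here a and t stand for \<Phi> before and after a step, b for the squared step length and
  d for the first-order change. The hypothesis on the square of d is Cauchy-Schwarz combined with a
  gradient bound by \<Phi>. The term linear in d keeps its exact coefficient, because drift and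
  centred noise are both hidden in it; all other terms of the expanded power are interpolated
  between \<open>a ^ j * b\<close> and \<open>b ^ Suc j\<close>.\<close>

lemma power_descent:
  fixes c L :: real
  assumes "c \<ge> 0" "L \<ge> 0"
  shows "\<exists>K\<ge>0. \<forall>(a::real) (b::real) (d::real) (t::real). a \<ge> 0 \<longrightarrow> b \<ge> 0 \<longrightarrow> t \<ge> 0 \<longrightarrow> d\<^sup>2 \<le> c * a * b \<longrightarrow> t \<le> a + d + L * b \<longrightarrow>
    t ^ Suc j \<le> a ^ Suc j + Suc j * a ^ j * d + K * (a ^ j * b + b ^ Suc j)"
proof (induction j)
  case 0
  show ?case
  proof (intro exI[of _ L] conjI allI impI)
    fix a b d t :: real
    assume "0 \<le> b" "t \<le> a + d + L * b"
    moreover have "L * b \<ge> 0" using assms \<open>0 \<le> b\<close> by simp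
    moreover have "a ^ Suc 0 + real (Suc 0) * a ^ 0 * d + L * (a ^ 0 * b + b ^ Suc 0) = a + d + L * b + L * b"
      by (simp add: distrib_left)
    ultimately have "t \<le> a ^ Suc 0 + real (Suc 0) * a ^ 0 * d + L * (a ^ 0 * b + b ^ Suc 0)"
      by linarith
    then show "t ^ Suc 0 \<le> a ^ Suc 0 + real (Suc 0) * a ^ 0 * d + L * (a ^ 0 * b + b ^ Suc 0)"
      by (subst power_Suc0_right)
  qed (use assms in auto)
next
  case (Suc j)
  from Suc.IH obtain K where K: "K \<ge> 0" and IH': "\<forall>(a::real) (b::real) (d::real) (t::real). a \<ge> 0 \<longrightarrow> b \<ge> 0 \<longrightarrow> t \<ge> 0 \<longrightarrow> d\<^sup>2 \<le> c * a * b \<longrightarrow> t \<le> a + d + L * b \<longrightarrow>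
    t ^ Suc j \<le> a ^ Suc j + Suc j * a ^ j * d + K * (a ^ j * b + b ^ Suc j)"
    by (elim exE conjE)
  have IH: "t ^ Suc j \<le> a ^ Suc j + Suc j * a ^ j * d + K * (a ^ j * b + b ^ Suc j)"
    if "a \<ge> 0" "b \<ge> 0" "t \<ge> 0" "d\<^sup>2 \<le> c * a * b" "t \<le> a + d + L * b" for a b d t :: real
    by (rule IH'[rule_format, OF that])
  \<comment> \<open>With e = c + 1 the quadratic bound on d yields \<bar>d\<bar> \<le> e (a + b).
    The constant K' collects the four estimates \<open>1\<close> to \<open>4\<close> below.\<close>
  define e where "e = c + 1"
  define K' where "K' = Suc j * c + L * (1 + 2 * Suc j * e) + 4 * K * (1 + e + L)"
  have e: "e \<ge> 0" using assms by (simp add: e_def)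
  have K': "K' \<ge> 0" using assms K e by (simp add: K'_def)
  have "t ^ Suc (Suc j) \<le> a ^ Suc (Suc j) + Suc (Suc j) * a ^ Suc j * d
          + K' * (a ^ Suc j * b + b ^ Suc (Suc j))"
    if h: "a \<ge> 0" "b \<ge> 0" "t \<ge> 0" "d\<^sup>2 \<le> c * a * b" "t \<le> a + d + L * b" for a b d t :: real
  proof -
    \<comment> \<open>\<open>X\<close> dominates every mixed monomial of total degree j + 2 that
      arises; the comparison of a with b decides which of its two summands does so.\<close>
    define X where "X = a ^ Suc j * b + b ^ Suc (Suc j)"
    have nn: "a ^ j \<ge> 0" "b ^ j \<ge> 0" using h by auto
    have X1: "a ^ Suc j * b \<le> X" and X2: "b ^ Suc (Suc j) \<le> X" using h by (auto simp: X_def)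
    have X3: "a ^ j * b\<^sup>2 \<le> X"
    proof (cases "b \<le> a")
      case True
      have "a ^ j * b\<^sup>2 = (a ^ j * b) * b" by (simp add: power2_eq_square)
      also have "\<dots> \<le> (a ^ j * b) * a" using h True by (intro mult_left_mono) auto
      finally show ?thesis using X1 by (simp add: ac_simps)
    next
      case False
      then have "a ^ j * b\<^sup>2 \<le> b ^ j * b\<^sup>2" using h by (intro mult_right_mono power_mono) auto
      then show ?thesis using X2 by (simp add: power2_eq_square ac_simps)
    qed
    have X4: "b ^ Suc j * a \<le> X"
    proof (cases "b \<le> a")
      case True
      then have "a * b * b ^ j \<le> a * b * a ^ j"
        using h by (intro mult_left_mono power_mono) auto
      then show ?thesis using X1 by (simp add: ac_simps)
    next
      case False
      then have "b ^ Suc j * a \<le> b ^ Suc j * b" using h by (intro mult_left_mono) auto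
      then show ?thesis using X2 by (simp add: ac_simps)
    qed
    have X0: "X \<ge> 0" using X2 h by (meson order_trans zero_le_power)
    have d: "\<bar>d\<bar> \<le> e * (a + b)"
    proof (rule abs_le_square_iff[THEN iffD2, of d "e * (a + b)", unfolded abs_of_nonneg[OF mult_nonneg_nonneg[OF e add_nonneg_nonneg[OF h(1,2)]]]])
      have "c * a * b \<le> e\<^sup>2 * (a * b)"
        using assms h unfolding e_def power2_eq_square
        by (auto simp: algebra_simps intro!: add_nonneg_nonneg)
      also have "\<dots> \<le> e\<^sup>2 * (a + b)\<^sup>2"
        using h by (intro mult_left_mono) (auto simp: power2_eq_square algebra_simps)
      finally show "d\<^sup>2 \<le> (e * (a + b))\<^sup>2" using h by (simp add: power_mult_distrib)
    qed
    \<comment> \<open>The factor is an upper bound of t and so nonnegative, although d may be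
      negative; this permits multiplying the induction hypothesis by it.\<close>
    have s: "a + d + L * b \<ge> 0" using h by linarith
    have "t ^ Suc (Suc j) \<le> (a + d + L * b) * t ^ Suc j"
      using h by (simp add: mult_right_mono)
    also have "\<dots> \<le> (a + d + L * b) * (a ^ Suc j + Suc j * a ^ j * d + K * (a ^ j * b + b ^ Suc j))"
      using s IH[OF h] by (intro mult_left_mono) auto
    also have "\<dots> = a ^ Suc (Suc j) + Suc (Suc j) * a ^ Suc j * d
        + (Suc j * a ^ j * d\<^sup>2 + L * (a ^ Suc j * b) + L * Suc j * (a ^ j * b * d)
          + K * ((a ^ j * b + b ^ Suc j) * (a + d + L * b)))"
      by (simp add: algebra_simps power2_eq_square)
    also have "\<dots> \<le> a ^ Suc (Suc j) + Suc (Suc j) * a ^ Suc j * d + K' * X"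
    proof -
      have 1: "Suc j * a ^ j * d\<^sup>2 \<le> Suc j * c * X"
      proof -
        have "Suc j * a ^ j * d\<^sup>2 \<le> Suc j * a ^ j * (c * a * b)"
          using h nn by (intro mult_left_mono) auto
        also have "\<dots> = Suc j * c * (a ^ Suc j * b)" by simp
        also have "\<dots> \<le> Suc j * c * X" using X1 assms by (intro mult_left_mono) auto
        finally show ?thesis .
      qed
      have 2: "L * (a ^ Suc j * b) \<le> L * X" using X1 assms by (intro mult_left_mono)
      have 3: "L * Suc j * (a ^ j * b * d) \<le> L * Suc j * (2 * e * X)"
      proof (intro mult_left_mono)
        have "a ^ j * b * d \<le> a ^ j * b * (e * (a + b))" using d h by (intro mult_left_mono) auto
        also have "\<dots> = e * (a ^ Suc j * b + a ^ j * b\<^sup>2)" by (simp add: algebra_simps power2_eq_square)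
        also have "\<dots> \<le> e * (X + X)" using X1 X3 e by (intro mult_left_mono add_mono)
        finally show "a ^ j * b * d \<le> 2 * e * X" by simp
      qed (use assms in auto)
      have 4: "K * ((a ^ j * b + b ^ Suc j) * (a + d + L * b)) \<le> K * (4 * (1 + e + L) * X)"
      proof (intro mult_left_mono)
        have "(a + d + L * b) \<le> (1 + e + L) * (a + b)"
        proof -
          have "L * a \<ge> 0" using assms h by simp
          then show ?thesis using d h by (simp add: algebra_simps)
        qed
        then have "(a ^ j * b + b ^ Suc j) * (a + d + L * b) \<le> (a ^ j * b + b ^ Suc j) * ((1 + e + L) * (a + b))"
          using h by (intro mult_left_mono) auto
        also have "\<dots> = (1 + e + L) * (a ^ Suc j * b + a ^ j * b\<^sup>2 + b ^ Suc j * a + b ^ Suc (Suc j))"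
          by (simp add: algebra_simps power2_eq_square)
        also have "\<dots> \<le> (1 + e + L) * (X + X + X + X)"
          using X1 X2 X3 X4 e assms by (intro mult_left_mono add_mono) auto
        finally show "(a ^ j * b + b ^ Suc j) * (a + d + L * b) \<le> 4 * (1 + e + L) * X"
          by (simp add: algebra_simps)
      qed (use K in auto)
      have "Suc j * c * X + L * X + L * Suc j * (2 * e * X) + K * (4 * (1 + e + L) * X) = 
        (Suc j * c + L + L * Suc j * 2 * e + 4 * K * (1 + e + L)) * X" by (simp add: algebra_simps)
      also have "\<dots> \<le> K' * X"
        using X0 assms K e by (intro mult_right_mono) (auto simp: K'_def algebra_simps)
      finally show ?thesis using 1 2 3 4 by linarith
    qed
    finally show ?thesis by (simp add: X_def)
  qed
  then show ?case using K' by (intro exI[of _ K'] conjI allI impI)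
qed

text \<open>Here \<open>s\<close> and \<open>t\<close> are the values of \<open>\<Phi>\<close> before and after a step of length at most
\<open>\<alpha> \<xi> (1 + n)\<close> from a point at distance \<open>n\<close> from the solution, and \<open>d\<close> is the first-order change of \<open>\<Phi>\<close>.\<close>

lemma ln_power_descent:
  fixes c1 c2 L p :: real
  assumes c1: "c1 > 0" and c2: "c2 > 0" and L: "L > 0" and p: "p > 1" "p \<le> real (Suc j)"
  shows "\<exists>K\<ge>0. \<forall>(\<alpha>::real) (\<xi>::real) (n::real) (s::real) (t::real) (d::real). 0 < \<alpha> \<longrightarrow> 0 < \<xi> \<longrightarrow> 0 \<le> n \<longrightarrow> 0 \<le> t \<longrightarrow>
    c1 * n\<^sup>2 \<le> s \<longrightarrow> t \<le> c2 * (n + \<alpha> * \<xi> * (1 + n))\<^sup>2 \<longrightarrow> d\<^sup>2 \<le> 2 * L * s * (\<alpha> * \<xi> * (1 + n))\<^sup>2 \<longrightarrow>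
    t \<le> s + d + L / 2 * (\<alpha> * \<xi> * (1 + n))\<^sup>2 \<longrightarrow>
    ln (1 + t ^ Suc j) \<le> ln (1 + s ^ Suc j) + Suc j * s ^ j * d / (1 + s ^ Suc j)
      + K * (\<alpha>\<^sup>2 * (s ^ j * (1 + n)\<^sup>2 / (1 + s ^ Suc j)) + \<alpha> powr p) * (1 + \<xi> powr p)"
proof -
  define m where "m = Suc j"
  have "\<exists>K\<ge>0. \<forall>(a::real) (b::real) (d::real) (t::real). a \<ge> 0 \<longrightarrow> b \<ge> 0 \<longrightarrow> t \<ge> 0 \<longrightarrow> d\<^sup>2 \<le> 2 * L * a * b \<longrightarrow> t \<le> a + d + L / 2 * b \<longrightarrow>
    t ^ m \<le> a ^ m + m * a ^ j * d + K * (a ^ j * b + b ^ m)"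
    unfolding m_def using L by (intro power_descent) auto
  then obtain K0 where K0: "K0 \<ge> 0" and pd': "\<forall>(a::real) (b::real) (d::real) (t::real). a \<ge> 0 \<longrightarrow> b \<ge> 0 \<longrightarrow> t \<ge> 0 \<longrightarrow> d\<^sup>2 \<le> 2 * L * a * b \<longrightarrow> t \<le> a + d + L / 2 * b \<longrightarrow>
    t ^ m \<le> a ^ m + m * a ^ j * d + K0 * (a ^ j * b + b ^ m)"
    by (elim exE conjE)
  note pd = pd'[rule_format]
  \<comment> \<open>The lower bound on s gives (1 + n)^2 \<le> 2 + 2 n^2 \<le> k (1 + s), and its
    m-th power is at most k1 (1 + s^m). For q > 1, k2 is the factor in 1 + t^m \<le> k2 (1 + s^m)
    q^(2m). In K, the part with K0 serves q \<le> 1; the other summands serve q > 1.\<close>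
  define k where "k = 2 + 2 / c1"
  define k1 where "k1 = (2 * k) ^ m"
  define k2 where "k2 = 1 + (4 * c2) ^ m * k1"
  define K where "K = K0 * (1 + 2 * k + k1) + 2 * m + k2 + m * (2 * L + 2 * k)"
  have k: "k \<ge> 0" "k1 \<ge> 0" "k2 \<ge> 1" using c1 c2 by (auto simp: k_def k1_def k2_def)
  have K: "K \<ge> 0" using K0 k L by (auto simp: K_def intro!: add_nonneg_nonneg)
  have "ln (1 + t ^ m) \<le> ln (1 + s ^ m) + m * s ^ j * d / (1 + s ^ m)
      + K * (\<alpha>\<^sup>2 * (s ^ j * (1 + n)\<^sup>2 / (1 + s ^ m)) + \<alpha> powr p) * (1 + \<xi> powr p)"
    if h: "0 < \<alpha>" "0 < \<xi>" "0 \<le> n" "0 \<le> t" "c1 * n\<^sup>2 \<le> s" "t \<le> c2 * (n + \<alpha> * \<xi> * (1 + n))\<^sup>2"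
       "d\<^sup>2 \<le> 2 * L * s * (\<alpha> * \<xi> * (1 + n))\<^sup>2" "t \<le> s + d + L / 2 * (\<alpha> * \<xi> * (1 + n))\<^sup>2"
    for \<alpha> \<xi> n s t d :: real
  proof -
    define q where "q = \<alpha> * \<xi>"
    define N where "N = 1 + n"
    define w where "w = 1 + s ^ m"
    define \<sigma> where "\<sigma> = s ^ j * N\<^sup>2 / w"
    have q: "q > 0" and N: "N \<ge> 1" using h by (auto simp: q_def N_def)
    have s: "s \<ge> 0" using h(5) c1 by (smt (verit) zero_le_mult_iff zero_le_power2)
    have w: "w \<ge> 1" using s by (simp add: w_def)
    have sj: "s ^ j \<le> w"
    proof (cases "s \<le> 1")
      case True
      then have "s ^ j \<le> 1" using s by (simp add: power_le_one)
      then show ?thesis using w by linarith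
    next
      case False
      then have "s ^ j \<le> s ^ m" by (intro power_increasing) (auto simp: m_def)
      then show ?thesis by (simp add: w_def)
    qed
    have N2: "N\<^sup>2 \<le> k * (1 + s)"
    proof -
      have "N\<^sup>2 \<le> 2 + 2 * n\<^sup>2" using sum_squares_ge_zero[of "1 - n" 0] by (simp add: N_def power2_eq_square algebra_simps)
      moreover have "n\<^sup>2 \<le> s / c1" using h(5) c1 by (simp add: field_simps)
      moreover have "k * (1 + s) = 2 + 2 * (s / c1) + 2 * s + 2 / c1" by (simp add: k_def algebra_simps add_divide_distrib)
      ultimately show ?thesis using s c1 by (smt (verit) divide_nonneg_pos)
    qed
    have sN: "s ^ j * N\<^sup>2 \<le> 2 * k * w"
    proof -
      have "s ^ j * N\<^sup>2 \<le> s ^ j * (k * (1 + s))" using N2 s by (intro mult_left_mono) auto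
      also have "\<dots> = k * (s ^ j + s ^ m)" by (simp add: m_def algebra_simps)
      also have "\<dots> \<le> k * (w + w)" using sj k w by (intro mult_left_mono add_mono) (auto simp: w_def)
      finally show ?thesis by simp
    qed
    have \<sigma>: "0 \<le> \<sigma>" "\<sigma> \<le> 2 * k" using sN w s by (auto simp: \<sigma>_def field_simps)
    have N2m: "(N\<^sup>2) ^ m \<le> k1 * w"
    proof -
      have "(1 + s) ^ m \<le> 2 ^ m * w"
      proof (cases "s \<le> 1")
        case True
        then have "(1 + s) ^ m \<le> 2 ^ m * 1" using s by (simp add: power_mono)
        also have "\<dots> \<le> 2 ^ m * w" using w by (intro mult_left_mono) auto
        finally show ?thesis .
      next
        case False
        then have "(1 + s) ^ m \<le> (2 * s) ^ m" by (intro power_mono) auto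
        also have "\<dots> \<le> 2 ^ m * w" by (simp add: power_mult_distrib w_def)
        finally show ?thesis .
      qed
      then have "k ^ m * (1 + s) ^ m \<le> k ^ m * (2 ^ m * w)" using k by (intro mult_left_mono) auto
      moreover have "(N\<^sup>2) ^ m \<le> (k * (1 + s)) ^ m" using N2 by (intro power_mono) auto
      ultimately show ?thesis by (simp add: k1_def power_mult_distrib ac_simps)
    qed
    have qp: "q powr p = \<alpha> powr p * \<xi> powr p" using h by (simp add: q_def powr_mult)
    \<comment> \<open>For q \<le> 1, ln u \<le> u - 1 reduces the claim to
      \<open>power_descent\<close> divided by w, and q^(2m) \<le> q^p because p \<le> m. For q > 1
      the logarithm of t^m exceeds ln w only by a constant and a multiple of ln q, and both are at
      most a multiple of q^p since p > 1.\<close>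
    have "ln (1 + t ^ m) \<le> ln w + m * s ^ j * d / w + K * (\<sigma> * \<alpha>\<^sup>2 * (1 + \<xi> powr p) + q powr p)"
    proof (cases "q \<le> 1")
      case True
      have "t ^ m \<le> s ^ m + m * s ^ j * d + K0 * (s ^ j * (q * N)\<^sup>2 + ((q * N)\<^sup>2) ^ m)"
        using h s by (intro pd) (auto simp: q_def N_def)
      then have *: "(t ^ m - s ^ m) / w \<le> (m * s ^ j * d + K0 * (s ^ j * (q * N)\<^sup>2 + ((q * N)\<^sup>2) ^ m)) / w"
        using w by (intro divide_right_mono) auto
      have "(1 + t ^ m) / w > 0" using h w by (intro divide_pos_pos add_pos_nonneg) auto
      have "ln (1 + t ^ m) - ln w = ln ((1 + t ^ m) / w)"
        using w zero_le_power[OF h(4), of m] by (subst ln_div) auto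
      also have "\<dots> \<le> (1 + t ^ m) / w - 1" using \<open>(1 + t ^ m) / w > 0\<close> by (rule ln_le_minus_one)
      also have "\<dots> = (t ^ m - s ^ m) / w" using w by (simp add: w_def field_simps)
      also have "\<dots> \<le> m * s ^ j * d / w + K0 * (\<sigma> * q\<^sup>2 + q\<^sup>2 ^ m * ((N\<^sup>2) ^ m / w))"
      proof -
        have "(s ^ j * (q * N)\<^sup>2) / w = \<sigma> * q\<^sup>2" by (simp add: \<sigma>_def power_mult_distrib)
        moreover have "((q * N)\<^sup>2) ^ m / w = q\<^sup>2 ^ m * ((N\<^sup>2) ^ m / w)" by (simp add: power_mult_distrib)
        moreover have "(u + K0 * (X + Y)) / w = u / w + K0 * (X / w + Y / w)" for u X Y
          by (simp add: add_divide_distrib distrib_left)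
        ultimately show ?thesis using * by (simp only:)
      qed
      also have "\<dots> \<le> m * s ^ j * d / w + K0 * ((\<sigma> * \<alpha>\<^sup>2 * (1 + \<xi> powr p) + 2 * k * q powr p) + k1 * q powr p)"
      proof (intro add_left_mono mult_left_mono add_mono K0)
        show "q\<^sup>2 ^ m * ((N\<^sup>2) ^ m / w) \<le> k1 * q powr p"
        proof -
          have "q\<^sup>2 ^ m = q ^ (2 * m)" by (simp add: power_mult)
          also have "\<dots> = q powr real (2 * m)" using q by (intro powr_realpow[symmetric])
          also have "\<dots> \<le> q powr p" using True q p by (intro powr_mono') (auto simp: m_def)
          finally have "q\<^sup>2 ^ m * ((N\<^sup>2) ^ m / w) \<le> q powr p * k1"
            using N2m w N by (intro mult_mono) (auto simp: field_simps)
          then show ?thesis by (simp add: ac_simps)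
        qed
        \<comment> \<open>For p \<ge> 2 the square of \<alpha> must survive, to be absorbed by the
          drift later, and \<xi>^2 is dominated by 1 + \<xi>^p. For p < 2 the moment of \<xi>^2 may
          be infinite; instead q^2 \<le> q^p, since q \<le> 1.\<close>
        show "\<sigma> * q\<^sup>2 \<le> \<sigma> * \<alpha>\<^sup>2 * (1 + \<xi> powr p) + 2 * k * q powr p"
        proof (cases "p \<ge> 2")
          case True
          have "\<xi>\<^sup>2 \<le> 1 + \<xi> powr p"
          proof (cases "\<xi> \<le> 1")
            case True
            then have "\<xi>\<^sup>2 \<le> 1" using h by (simp add: power_le_one)
            then show ?thesis using powr_ge_zero[of \<xi> p] by linarith
          next
            case False
            then have "\<xi> powr 2 \<le> \<xi> powr p" using \<open>p \<ge> 2\<close> by (intro powr_mono) auto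
            then show ?thesis using h by (simp add: powr_numeral)
          qed
          then have "\<sigma> * \<alpha>\<^sup>2 * \<xi>\<^sup>2 \<le> \<sigma> * \<alpha>\<^sup>2 * (1 + \<xi> powr p)" using \<sigma> by (intro mult_left_mono) auto
          moreover have "2 * k * q powr p \<ge> 0" using k by simp
          ultimately show ?thesis by (simp add: q_def power_mult_distrib)
        next
          case False
          have "q\<^sup>2 = q powr 2" using q by (simp add: powr_numeral)
          also have "\<dots> \<le> q powr p" using True q False by (intro powr_mono') auto
          finally have "\<sigma> * q\<^sup>2 \<le> 2 * k * q powr p" using \<sigma> k by (intro mult_mono) auto
          moreover have "\<sigma> * \<alpha>\<^sup>2 * (1 + \<xi> powr p) \<ge> 0" using \<sigma> by simp
          ultimately show ?thesis by linarith
        qed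
      qed
      also have "\<dots> = m * s ^ j * d / w + (K0 * (\<sigma> * \<alpha>\<^sup>2 * (1 + \<xi> powr p)) + K0 * (2 * k + k1) * q powr p)"
        by (simp add: algebra_simps)
      also have "\<dots> \<le> m * s ^ j * d / w + (K * (\<sigma> * \<alpha>\<^sup>2 * (1 + \<xi> powr p)) + K * q powr p)"
      proof (intro add_left_mono add_mono mult_right_mono)
        have "K0 * k \<ge> 0" "K0 * k1 \<ge> 0" "m * (2 * L + 2 * k) \<ge> 0" using K0 k L by simp_all
        then show "K0 \<le> K" "K0 * (2 * k + k1) \<le> K" using K0 k by (simp_all add: K_def distrib_left)
      qed (use \<sigma> in auto)
      finally show ?thesis by (simp add: distrib_left)
    next
      case False
      have q1: "q \<ge> 1" "q \<le> q powr p" using False powr_mono[of 1 p q] p by auto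
      have "t \<le> 4 * c2 * N\<^sup>2 * q\<^sup>2"
      proof -
        have "1 * N \<le> q * N" using q1 N by (intro mult_right_mono) auto
        moreover have "n \<le> N" by (simp add: N_def)
        ultimately have "n + q * N \<le> 2 * (q * N)" by linarith
        then have "(n + q * N)\<^sup>2 \<le> (2 * (q * N))\<^sup>2" using h q N by (intro power_mono) auto
        then have "c2 * (n + q * N)\<^sup>2 \<le> c2 * (2 * (q * N))\<^sup>2" using c2 by (intro mult_left_mono) auto
        moreover have "t \<le> c2 * (n + q * N)\<^sup>2" using h(6) by (simp add: q_def N_def)
        moreover have "c2 * (2 * (q * N))\<^sup>2 = 4 * c2 * N\<^sup>2 * q\<^sup>2" by (simp add: power_mult_distrib)
        ultimately show ?thesis by linarith
      qed
      then have "t ^ m \<le> (4 * c2 * N\<^sup>2 * q\<^sup>2) ^ m" using h by (intro power_mono) auto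
      also have "\<dots> = (4 * c2) ^ m * q\<^sup>2 ^ m * (N\<^sup>2) ^ m" by (simp add: power_mult_distrib ac_simps)
      also have "\<dots> \<le> (4 * c2) ^ m * q\<^sup>2 ^ m * (k1 * w)" using N2m c2 by (intro mult_left_mono) auto
      finally have "1 + t ^ m \<le> 1 + (4 * c2) ^ m * k1 * (w * q ^ (2 * m))"
        by (simp add: ac_simps flip: power_mult)
      also have "\<dots> \<le> w * q ^ (2 * m) + (4 * c2) ^ m * k1 * (w * q ^ (2 * m))"
        using mult_mono[OF w one_le_power[OF q1(1), of "2 * m"]] w by (intro add_right_mono) auto
      also have "\<dots> = k2 * (w * q ^ (2 * m))" by (simp add: k2_def algebra_simps)
      finally have "ln (1 + t ^ m) \<le> ln (k2 * (w * q ^ (2 * m)))"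
        using h k w q by (subst ln_le_cancel_iff) (auto intro!: add_pos_nonneg mult_pos_pos)
      also have "\<dots> = ln k2 + (ln w + 2 * m * ln q)"
        using k w q by (simp add: ln_mult ln_realpow)
      also have "\<dots> \<le> k2 * q powr p + (ln w + 2 * m * q powr p)"
      proof (intro add_mono order_refl mult_left_mono)
        have "ln k2 \<le> k2 * 1" using ln_le_minus_one[of k2] k by simp
        also have "\<dots> \<le> k2 * q powr p" using q1 k by (intro mult_left_mono) auto
        finally show "ln k2 \<le> k2 * q powr p" .
        show "ln q \<le> q powr p" using ln_le_minus_one[of q] q q1 by simp
      qed auto
      finally have 1: "ln (1 + t ^ m) \<le> ln w + (k2 + 2 * m) * q powr p" by (simp add: algebra_simps)
      \<comment> \<open>The linear term also occurs in the target and may be very negative for a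
        long step. Its size is therefore charged to the remainder: after division by w it is of
        order q, hence at most of order q^p.\<close>
      have d: "\<bar>d\<bar> \<le> q * (2 * L * s + N\<^sup>2)"
      proof -
        have "d\<^sup>2 \<le> q\<^sup>2 * ((2 * L * s) * N\<^sup>2)" using h(7) by (simp add: q_def N_def power_mult_distrib ac_simps)
        also have "\<dots> \<le> q\<^sup>2 * (2 * L * s + N\<^sup>2)\<^sup>2"
        proof (intro mult_left_mono)
          have "0 \<le> (2 * L * s)\<^sup>2 + (2 * L * s) * N\<^sup>2 + (N\<^sup>2)\<^sup>2" using L s by simp
          then show "(2 * L * s) * N\<^sup>2 \<le> (2 * L * s + N\<^sup>2)\<^sup>2" unfolding power2_sum by linarith
        qed auto
        finally have "d\<^sup>2 \<le> (q * (2 * L * s + N\<^sup>2))\<^sup>2" by (simp add: power_mult_distrib)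
        then have "\<bar>d\<bar> \<le> \<bar>q * (2 * L * s + N\<^sup>2)\<bar>" by (simp add: abs_le_square_iff)
        also have "\<dots> = q * (2 * L * s + N\<^sup>2)" using q L s by (intro abs_of_nonneg) auto
        finally show ?thesis .
      qed
      have 2: "- (m * s ^ j * d / w) \<le> m * (2 * L + 2 * k) * q powr p"
      proof -
        have "- d * s ^ j \<le> q * (2 * L * s + N\<^sup>2) * s ^ j" using d s by (intro mult_right_mono) auto
        also have "\<dots> = q * (2 * L * s ^ m + s ^ j * N\<^sup>2)" by (simp add: m_def algebra_simps)
        also have "\<dots> \<le> q * (2 * L * w + 2 * k * w)"
          using q sN L by (intro mult_left_mono add_mono) (auto simp: w_def)
        finally have "(- d * s ^ j) / w \<le> (q * (2 * L * w + 2 * k * w)) / w" using w by (intro divide_right_mono) auto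
        also have "\<dots> = (2 * L + 2 * k) * q" using w by (simp add: field_simps)
        also have "\<dots> \<le> (2 * L + 2 * k) * q powr p" using q1 L k by (intro mult_left_mono) auto
        finally have "m * ((- d * s ^ j) / w) \<le> m * ((2 * L + 2 * k) * q powr p)" by (intro mult_left_mono) auto
        then show ?thesis by (simp add: ac_simps)
      qed
      have "0 \<le> K * (\<sigma> * \<alpha>\<^sup>2 * (1 + \<xi> powr p))" using K \<sigma> by simp
      moreover have "K0 * (1 + 2 * k + k1) * q powr p \<ge> 0" using K0 k by simp
      ultimately show ?thesis using 1 2 unfolding K_def
        by (simp only: distrib_left distrib_right)
    qed
    also have "\<dots> \<le> ln w + m * s ^ j * d / w + K * (\<alpha>\<^sup>2 * \<sigma> + \<alpha> powr p) * (1 + \<xi> powr p)"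
    proof -
      have "\<sigma> * \<alpha>\<^sup>2 * (1 + \<xi> powr p) + q powr p \<le> (\<alpha>\<^sup>2 * \<sigma> + \<alpha> powr p) * (1 + \<xi> powr p)"
        by (simp add: qp algebra_simps)
      from mult_left_mono[OF this K] show ?thesis by (simp add: mult.assoc)
    qed
    finally show ?thesis unfolding \<sigma>_def N_def w_def .
  qed
  then show ?thesis using K unfolding m_def by (intro exI[of _ K] conjI allI impI)
qed

text \<open>The threshold is s = 2 k \<alpha> / \<delta>. Above it, one factor s outweighs k
  \<alpha>, and half of the drift absorbs the term. Below it, s^j is of order \<alpha>^j, so the
  whole term is of order \<alpha>^(j + 2), which is at most \<alpha>^p for \<alpha> \<le> 1.\<close>

lemma second_order_absorb:
  fixes c1 \<delta> p :: real
  assumes c1: "c1 > 0" and \<delta>: "\<delta> > 0" and p: "p \<le> real (Suc j)"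
  shows "\<exists>K\<ge>0. \<exists>a>0. \<forall>(\<alpha>::real) (n::real) (s::real). 0 < \<alpha> \<longrightarrow> \<alpha> \<le> a \<longrightarrow> 0 \<le> n \<longrightarrow> c1 * n\<^sup>2 \<le> s \<longrightarrow>
    \<alpha>\<^sup>2 * (s ^ j * (1 + n)\<^sup>2 / (1 + s ^ Suc j)) \<le> \<delta> * \<alpha> * (s ^ Suc j / (1 + s ^ Suc j)) + K * \<alpha> powr p"
proof -
  define k where "k = 2 + 2 / c1"
  \<comment> \<open>The bound 1 allows powers of \<alpha> to be lowered to p. The other bound means
    k \<alpha> \<le> \<delta> / 2, which lets the second half of the drift absorb the part of (1 +
    n)^2 that grows like s.\<close>
  define a where "a = min 1 (\<delta> / (2 * k))"
  define K where "K = k * (2 * k / \<delta>) ^ j"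
  have k: "k > 0" using c1 by (auto simp: k_def intro!: add_pos_nonneg)
  have a: "a > 0" using k \<delta> by (auto simp: a_def)
  have K: "K \<ge> 0" using k \<delta> by (auto simp: K_def)
  have "\<alpha>\<^sup>2 * (s ^ j * (1 + n)\<^sup>2 / (1 + s ^ Suc j)) \<le> \<delta> * \<alpha> * (s ^ Suc j / (1 + s ^ Suc j)) + K * \<alpha> powr p"
    if h: "0 < \<alpha>" "\<alpha> \<le> a" "0 \<le> n" "c1 * n\<^sup>2 \<le> s" for \<alpha> n s :: real
  proof -
    have s: "s \<ge> 0" using h(4) c1 by (smt (verit) zero_le_mult_iff zero_le_power2)
    define w where "w = 1 + s ^ Suc j"
    have w: "w \<ge> 1" using s by (simp add: w_def)
    have \<alpha>: "\<alpha> \<le> 1" "k * \<alpha> \<le> \<delta> / 2" using h k by (auto simp: a_def field_simps)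
    have N2: "(1 + n)\<^sup>2 \<le> k * (1 + s)"
    proof -
      have "(1 + n)\<^sup>2 \<le> 2 + 2 * n\<^sup>2" using sum_squares_ge_zero[of "1 - n" 0] by (simp add: power2_eq_square algebra_simps)
      moreover have "n\<^sup>2 \<le> s / c1" using h(4) c1 by (simp add: field_simps)
      moreover have "k * (1 + s) = 2 + 2 * (s / c1) + 2 * s + 2 / c1" by (simp add: k_def algebra_simps add_divide_distrib)
      moreover have "2 / c1 \<ge> 0" using c1 by simp
      ultimately show ?thesis using s by linarith
    qed
    have *: "k * \<alpha> * s ^ j \<le> \<delta> / 2 * s ^ Suc j + K * \<alpha> ^ Suc j"
    proof (cases "2 * k * \<alpha> / \<delta> \<le> s")
      case True
      then have "k * \<alpha> \<le> \<delta> / 2 * s" using \<delta> by (simp add: field_simps)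
      then have "k * \<alpha> * s ^ j \<le> \<delta> / 2 * s * s ^ j" using s by (intro mult_right_mono) auto
      moreover have "K * \<alpha> ^ Suc j \<ge> 0" using K h by simp
      ultimately show ?thesis by simp
    next
      case False
      then have "k * \<alpha> * s ^ j \<le> k * \<alpha> * (2 * k * \<alpha> / \<delta>) ^ j"
        using s k h by (intro mult_left_mono power_mono) auto
      also have "\<dots> = K * \<alpha> ^ Suc j" by (simp add: K_def power_mult_distrib power_divide)
      moreover have "\<delta> / 2 * s ^ Suc j \<ge> 0" using s \<delta> by simp
      ultimately show ?thesis by linarith
    qed
    have "\<alpha> * (s ^ j * (1 + n)\<^sup>2) \<le> \<alpha> * (s ^ j * (k * (1 + s)))"
      using N2 s h by (intro mult_left_mono) auto
    also have "\<dots> = k * \<alpha> * s ^ j + k * \<alpha> * s ^ Suc j" by (simp add: algebra_simps)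
    also have "\<dots> \<le> (\<delta> / 2 * s ^ Suc j + K * \<alpha> ^ Suc j) + \<delta> / 2 * s ^ Suc j"
      using * \<alpha>(2) s by (intro add_mono mult_right_mono) auto
    also have "\<dots> \<le> \<delta> * s ^ Suc j + K * \<alpha> ^ Suc j * w"
      using mult_left_mono[OF w, of "K * \<alpha> ^ Suc j"] K h by simp
    finally have "(\<alpha> * (s ^ j * (1 + n)\<^sup>2)) / w \<le> (\<delta> * s ^ Suc j + K * \<alpha> ^ Suc j * w) / w"
      using w by (intro divide_right_mono) auto
    also have "\<dots> = \<delta> * (s ^ Suc j / w) + K * \<alpha> ^ Suc j" using w by (simp add: field_simps)
    finally have "\<alpha> * ((\<alpha> * (s ^ j * (1 + n)\<^sup>2)) / w) \<le> \<alpha> * (\<delta> * (s ^ Suc j / w) + K * \<alpha> ^ Suc j)"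
      using h by (intro mult_left_mono) auto
    also have "\<dots> = \<delta> * \<alpha> * (s ^ Suc j / w) + K * \<alpha> ^ (j + 2)" by (simp add: algebra_simps)
    also have "\<alpha> ^ (j + 2) = \<alpha> powr real (j + 2)" using h by (intro powr_realpow[symmetric])
    also have "K * \<alpha> powr real (j + 2) \<le> K * \<alpha> powr p"
      using h \<alpha> p K by (intro mult_left_mono powr_mono') auto
    finally show ?thesis by (simp add: w_def power2_eq_square ac_simps)
  qed
  then show ?thesis using a K by (intro exI[of _ K] exI[of _ a] conjI allI impI)
qed

text \<open>A free \<epsilon> lets the share of the drift spent on the remainder be fixed once the
  moment constant of the noise is known. The price is a threshold on the step size and a constant K
  that depends on \<epsilon>.\<close>

lemma ln_power_descent_absorbed:
  fixes c1 c2 L p \<epsilon> :: real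
  assumes c1: "c1 > 0" and c2: "c2 > 0" and L: "L > 0" and p: "p > 1" "p \<le> real (Suc j)" and \<epsilon>: "\<epsilon> > 0"
  shows "\<exists>K\<ge>0. \<exists>a>0. \<forall>(\<alpha>::real) (\<xi>::real) (n::real) (s::real) (t::real) (d::real). 0 < \<alpha> \<longrightarrow> \<alpha> \<le> a \<longrightarrow> 0 < \<xi> \<longrightarrow> 0 \<le> n \<longrightarrow> 0 \<le> t \<longrightarrow>
    c1 * n\<^sup>2 \<le> s \<longrightarrow> t \<le> c2 * (n + \<alpha> * \<xi> * (1 + n))\<^sup>2 \<longrightarrow> d\<^sup>2 \<le> 2 * L * s * (\<alpha> * \<xi> * (1 + n))\<^sup>2 \<longrightarrow>
    t \<le> s + d + L / 2 * (\<alpha> * \<xi> * (1 + n))\<^sup>2 \<longrightarrow>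
    ln (1 + t ^ Suc j) \<le> ln (1 + s ^ Suc j) + Suc j * s ^ j * d / (1 + s ^ Suc j)
      + (\<epsilon> * \<alpha> * (s ^ Suc j / (1 + s ^ Suc j)) + K * \<alpha> powr p) * (1 + \<xi> powr p)"
proof -
  from ln_power_descent[OF c1 c2 L p] obtain K where K: "K \<ge> 0" and
   f1: "\<forall>(\<alpha>::real) (\<xi>::real) (n::real) (s::real) (t::real) (d::real). 0 < \<alpha> \<longrightarrow> 0 < \<xi> \<longrightarrow> 0 \<le> n \<longrightarrow> 0 \<le> t \<longrightarrow>
    c1 * n\<^sup>2 \<le> s \<longrightarrow> t \<le> c2 * (n + \<alpha> * \<xi> * (1 + n))\<^sup>2 \<longrightarrow> d\<^sup>2 \<le> 2 * L * s * (\<alpha> * \<xi> * (1 + n))\<^sup>2 \<longrightarrow>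
    t \<le> s + d + L / 2 * (\<alpha> * \<xi> * (1 + n))\<^sup>2 \<longrightarrow>
    ln (1 + t ^ Suc j) \<le> ln (1 + s ^ Suc j) + Suc j * s ^ j * d / (1 + s ^ Suc j)
      + K * (\<alpha>\<^sup>2 * (s ^ j * (1 + n)\<^sup>2 / (1 + s ^ Suc j)) + \<alpha> powr p) * (1 + \<xi> powr p)"
    by (elim exE conjE)
  \<comment> \<open>The denominator K + 1 gives K \<delta> \<le> \<epsilon> and covers K =
    0.\<close>
  define \<delta> where "\<delta> = \<epsilon> / (K + 1)"
  have \<delta>: "\<delta> > 0" "K * \<delta> \<le> \<epsilon>" using \<epsilon> K by (auto simp: \<delta>_def field_simps)
  from second_order_absorb[OF c1 \<delta>(1) p(2)] obtain K' a where K': "K' \<ge> 0" and a: "a > 0" and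
   f2: "\<forall>(\<alpha>::real) (n::real) (s::real). 0 < \<alpha> \<longrightarrow> \<alpha> \<le> a \<longrightarrow> 0 \<le> n \<longrightarrow> c1 * n\<^sup>2 \<le> s \<longrightarrow>
    \<alpha>\<^sup>2 * (s ^ j * (1 + n)\<^sup>2 / (1 + s ^ Suc j)) \<le> \<delta> * \<alpha> * (s ^ Suc j / (1 + s ^ Suc j)) + K' * \<alpha> powr p"
    by (elim exE conjE)
  show ?thesis
  proof (rule exI[of _ "K * (K' + 1)"], rule conjI[OF _ exI[of _ a]], goal_cases)
    case 1 then show ?case using K K' by simp
  next
    case 2
    show ?case
    proof (intro conjI allI impI a)
      fix \<alpha> \<xi> n s t d :: real
      assume h: "0 < \<alpha>" "\<alpha> \<le> a" "0 < \<xi>" "0 \<le> n" "0 \<le> t" "c1 * n\<^sup>2 \<le> s" "t \<le> c2 * (n + \<alpha> * \<xi> * (1 + n))\<^sup>2"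
       "d\<^sup>2 \<le> 2 * L * s * (\<alpha> * \<xi> * (1 + n))\<^sup>2" "t \<le> s + d + L / 2 * (\<alpha> * \<xi> * (1 + n))\<^sup>2"
      define \<tau> where "\<tau> = s ^ Suc j / (1 + s ^ Suc j)"
      have s: "s \<ge> 0" using h(6) c1 by (smt (verit) zero_le_mult_iff zero_le_power2)
      then have \<tau>: "\<tau> \<ge> 0" by (simp add: \<tau>_def)
      have "K * (\<alpha>\<^sup>2 * (s ^ j * (1 + n)\<^sup>2 / (1 + s ^ Suc j)) + \<alpha> powr p) \<le> K * ((\<delta> * \<alpha> * \<tau> + K' * \<alpha> powr p) + \<alpha> powr p)"
        unfolding \<tau>_def using f2[rule_format, OF h(1,2,4,6)] K by (intro mult_left_mono add_right_mono)
      also have "\<dots> = (K * \<delta>) * (\<alpha> * \<tau>) + K * (K' + 1) * \<alpha> powr p" by (simp add: algebra_simps)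
      also have "\<dots> \<le> \<epsilon> * (\<alpha> * \<tau>) + K * (K' + 1) * \<alpha> powr p"
        using \<delta> h \<tau> by (intro add_right_mono mult_right_mono) auto
      finally have "K * (\<alpha>\<^sup>2 * (s ^ j * (1 + n)\<^sup>2 / (1 + s ^ Suc j)) + \<alpha> powr p) * (1 + \<xi> powr p)
          \<le> (\<epsilon> * (\<alpha> * \<tau>) + K * (K' + 1) * \<alpha> powr p) * (1 + \<xi> powr p)"
        by (intro mult_right_mono) auto
      with f1[rule_format, OF h(1,3-9)]
      show "ln (1 + t ^ Suc j) \<le> ln (1 + s ^ Suc j) + Suc j * s ^ j * d / (1 + s ^ Suc j)
        + (\<epsilon> * \<alpha> * (s ^ Suc j / (1 + s ^ Suc j)) + K * (K' + 1) * \<alpha> powr p) * (1 + \<xi> powr p)"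
        unfolding \<tau>_def by (simp only: mult.assoc)
    qed
  qed
qed

section \<open>Filtration, gradient and noise\<close>

lemma space_natural_filtration [simp]: "space (natural_filtration M X k) = space M"
  by (simp add: natural_filtration_def space_measure_of_conv)

lemma sets_natural_filtration:
  "sets (natural_filtration M X k) = sigma_sets (space M) (\<Union>i\<in>{..k}. {X i -` A \<inter> space M | A. A \<in> sets borel})"
  unfolding natural_filtration_def by (intro sets_measure_of) auto

lemma subalgebra_natural_filtration:
  assumes "\<And>i. i \<le> k \<Longrightarrow> X i \<in> borel_measurable M"
  shows "subalgebra M (natural_filtration M X k)"
  unfolding subalgebra_def sets_natural_filtration space_natural_filtration
  using assms by (intro conjI refl sets.sigma_sets_subset) (auto intro: measurable_sets)

lemma sets_natural_filtration_mono:
  "k \<le> l \<Longrightarrow> sets (natural_filtration M X k) \<subseteq> sets (natural_filtration M X l)"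
  unfolding sets_natural_filtration by (intro sigma_sets_mono' UN_mono) auto

lemma measurable_natural_filtration:
  "i \<le> k \<Longrightarrow> X i \<in> borel_measurable (natural_filtration M X k)"
  by (rule measurableI) (auto simp: sets_natural_filtration intro!: sigma_sets.Basic)

text \<open>The test point y - g y / L minimizes the quadratic upper bound at y, and even there this
  bound must be nonnegative.\<close>

lemma smooth_nonneg_gradient_bound:
  fixes f :: "'a::real_inner \<Rightarrow> real"
  assumes nonneg: "\<And>y. f y \<ge> 0" and L: "L > 0"
    and smooth: "\<And>y z. f z \<le> f y + g y \<bullet> (z - y) + L / 2 * (norm (z - y))\<^sup>2"
  shows "(norm (g y))\<^sup>2 \<le> 2 * L * f y"
proof -
  have "0 \<le> f (y - (1 / L) *\<^sub>R g y)" by (rule nonneg)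
  also have "\<dots> \<le> f y - (norm (g y))\<^sup>2 / L + L / 2 * (norm (g y) / L)\<^sup>2"
    using smooth[of "y - (1 / L) *\<^sub>R g y" y] L by (simp add: power2_norm_eq_inner)
  also have "\<dots> = f y - (norm (g y))\<^sup>2 / (2 * L)"
    using L by (simp add: power2_eq_square field_simps)
  finally show ?thesis using L by (simp add: field_simps)
qed

text \<open>A derivative need not be continuous, but each of its coordinates is a pointwise limit of
  difference quotients of a continuous function.\<close>

lemma borel_measurable_gradient:
  fixes f :: "'a::euclidean_space \<Rightarrow> real"
  assumes deriv: "\<And>y. (f has_derivative (\<lambda>h. g y \<bullet> h)) (at y)"
  shows "g \<in> borel_measurable borel"
proof (subst borel_measurable_euclidean_space, intro ballI)
  fix i :: 'a assume "i \<in> Basis"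
  have "continuous_on UNIV f"
    using deriv by (intro differentiable_imp_continuous_on) (auto simp: differentiable_on_def differentiable_def intro: has_derivative_at_withinI)
  then have [measurable]: "f \<in> borel_measurable borel" by (rule borel_measurable_continuous_onI)
  show "(\<lambda>y. g y \<bullet> i) \<in> borel_measurable borel"
  proof (rule borel_measurable_LIMSEQ_real)
    fix y :: 'a
    have 1: "((\<lambda>t::real. y + t *\<^sub>R i) has_derivative (\<lambda>t. t *\<^sub>R i)) (at 0)"
      by (auto intro!: derivative_eq_intros)
    have "((\<lambda>t. f (y + t *\<^sub>R i)) has_derivative (\<lambda>t. g y \<bullet> (t *\<^sub>R i))) (at 0)"
      using has_derivative_compose[OF 1, of f "\<lambda>h. g y \<bullet> h"] deriv[of y] by simp
    then have "((\<lambda>t. f (y + t *\<^sub>R i)) has_field_derivative (g y \<bullet> i)) (at 0)"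
      by (simp add: has_field_derivative_def mult_commute_abs)
    then have "((\<lambda>h. (f (y + h *\<^sub>R i) - f y) / h) \<longlongrightarrow> g y \<bullet> i) (at 0)" by (simp add: DERIV_def)
    moreover have "filterlim (\<lambda>n. inverse (real (Suc n))) (at 0) sequentially"
      unfolding filterlim_at using LIMSEQ_inverse_real_of_nat by auto
    ultimately show "(\<lambda>n. (f (y + inverse (real (Suc n)) *\<^sub>R i) - f y) / inverse (real (Suc n))) \<longlonglongrightarrow> g y \<bullet> i"
      by (rule filterlim_compose)
  qed measurable
qed

text \<open>Boundedness of \<open>G\<close> makes the inner product integrable although
  \<open>w\<close> has only a first moment. Known factors are then pulled out coordinate by
  coordinate, in line with the componentwise form of the unbiasedness assumption.\<close>

lemma (in prob_space) expectation_inner_cond_centered: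
  fixes w G :: "'a \<Rightarrow> real^'n"
  assumes sub: "subalgebra M F" and w: "integrable M w"
    and centered: "\<And>i. AE \<omega> in M. real_cond_exp M F (\<lambda>\<omega>. w \<omega> $ i) \<omega> = 0"
    and G: "G \<in> borel_measurable F" and bound: "\<And>\<omega>. norm (G \<omega>) \<le> b"
  shows "integrable M (\<lambda>\<omega>. G \<omega> \<bullet> w \<omega>)" "(\<integral>\<omega>. G \<omega> \<bullet> w \<omega> \<partial>M) = 0"
proof -
  interpret finite_measure_subalgebra M F using sub by unfold_locales
  have [measurable]: "w \<in> borel_measurable M" using w by measurable
  have wi: "(\<lambda>\<omega>. w \<omega> $ i) = (\<lambda>\<omega>. w \<omega> \<bullet> axis i 1)" for i by (simp add: inner_axis)
  have Gi: "(\<lambda>\<omega>. G \<omega> $ i) \<in> borel_measurable F" for i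
  proof -
    have "(\<lambda>\<omega>. G \<omega> \<bullet> axis i 1) \<in> borel_measurable F" using G by measurable
    then show ?thesis by (simp add: inner_axis)
  qed
  have wint: "integrable M (\<lambda>\<omega>. w \<omega> $ i)" for i unfolding wi using w by simp
  have Gint: "integrable M (\<lambda>\<omega>. G \<omega> $ i * w \<omega> $ i)" for i
  proof (rule Bochner_Integration.integrable_bound)
    show "integrable M (\<lambda>\<omega>. b * norm (w \<omega>))" using w by simp
    show "(\<lambda>\<omega>. G \<omega> $ i * w \<omega> $ i) \<in> borel_measurable M"
      using measurable_from_subalg[OF sub Gi, of i] wint[of i] by measurable
    show "AE \<omega> in M. norm (G \<omega> $ i * w \<omega> $ i) \<le> norm (b * norm (w \<omega>))"
    proof (rule AE_I2)
      fix \<omega>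
      have "\<bar>G \<omega> $ i\<bar> * \<bar>w \<omega> $ i\<bar> \<le> b * norm (w \<omega>)"
        using component_le_norm_cart[of "G \<omega>" i] component_le_norm_cart[of "w \<omega>" i] bound[of \<omega>]
        by (intro mult_mono) auto
      then show "norm (G \<omega> $ i * w \<omega> $ i) \<le> norm (b * norm (w \<omega>))"
        by (simp add: abs_mult) (metis abs_ge_self mult_right_mono norm_ge_zero order_trans)
    qed
  qed
  have zero: "(\<integral>\<omega>. G \<omega> $ i * w \<omega> $ i \<partial>M) = 0" for i
  proof -
    have "(\<integral>\<omega>. G \<omega> $ i * w \<omega> $ i \<partial>M) = (\<integral>\<omega>. G \<omega> $ i * real_cond_exp M F (\<lambda>\<omega>. w \<omega> $ i) \<omega> \<partial>M)"
      using wint by (intro real_cond_exp_intg(2)[symmetric] Gint Gi) auto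
    also have "\<dots> = (\<integral>\<omega>. 0 \<partial>M)"
      using centered[of i] measurable_from_subalg[OF sub Gi, of i] by (intro integral_cong_AE) auto
    finally show ?thesis by simp
  qed
  show "integrable M (\<lambda>\<omega>. G \<omega> \<bullet> w \<omega>)" unfolding inner_vec_def using Gint by simp
  show "(\<integral>\<omega>. G \<omega> \<bullet> w \<omega> \<partial>M) = 0" unfolding inner_vec_def using Gint zero by simp
qed

text \<open>The extended nonnegative conditional expectation presupposes no integrability of
  \<open>g\<close>. The weight \<open>h\<close> compensates the growth of \<open>D\<close>, so
  integrability of the weighted product comes out of the same estimate as its bound.\<close>

lemma (in prob_space) expectation_le_nn_cond_exp_bound:
  fixes h g D :: "'a \<Rightarrow> real"
  assumes sub: "subalgebra M F"
    and h: "h \<in> borel_measurable F" "\<And>\<omega>. h \<omega> \<ge> 0"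
    and g: "g \<in> borel_measurable M" "\<And>\<omega>. g \<omega> \<ge> 0"
    and D: "AE \<omega> in M. nn_cond_exp M F (\<lambda>\<omega>. ennreal (g \<omega>)) \<omega> \<le> ennreal (D \<omega>)"
    and bound: "\<And>\<omega>. h \<omega> * D \<omega> \<le> e \<omega>" and e: "integrable M e" "\<And>\<omega>. e \<omega> \<ge> 0"
  shows "integrable M (\<lambda>\<omega>. h \<omega> * g \<omega>)" "(\<integral>\<omega>. h \<omega> * g \<omega> \<partial>M) \<le> (\<integral>\<omega>. e \<omega> \<partial>M)"
proof -
  interpret finite_measure_subalgebra M F using sub by unfold_locales
  have hM[measurable]: "h \<in> borel_measurable M" using measurable_from_subalg[OF sub h(1)] .
  note [measurable] = g(1)
  have "(\<integral>\<^sup>+\<omega>. ennreal (h \<omega> * g \<omega>) \<partial>M) = (\<integral>\<^sup>+\<omega>. ennreal (h \<omega>) * ennreal (g \<omega>) \<partial>M)"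
    using h g by (simp add: ennreal_mult)
  also have "\<dots> = (\<integral>\<^sup>+\<omega>. ennreal (h \<omega>) * nn_cond_exp M F (\<lambda>\<omega>. ennreal (g \<omega>)) \<omega> \<partial>M)"
    using h(1) by (intro nn_cond_exp_intg[symmetric]) auto
  also have "\<dots> \<le> (\<integral>\<^sup>+\<omega>. ennreal (e \<omega>) \<partial>M)"
  proof (rule nn_integral_mono_AE, rule AE_mp[OF D], intro AE_I2 impI)
    fix \<omega> assume D: "nn_cond_exp M F (\<lambda>\<omega>. ennreal (g \<omega>)) \<omega> \<le> ennreal (D \<omega>)"
    have "ennreal (h \<omega>) * nn_cond_exp M F (\<lambda>\<omega>. ennreal (g \<omega>)) \<omega> \<le> ennreal (h \<omega>) * ennreal (D \<omega>)"
      using D by (rule mult_left_mono) simp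
    also have "\<dots> = ennreal (h \<omega> * D \<omega>)" using h(2) by (simp add: ennreal_mult')
    also have "\<dots> \<le> ennreal (e \<omega>)" using bound[of \<omega>] by (intro ennreal_leI) auto
    finally show "ennreal (h \<omega>) * nn_cond_exp M F (\<lambda>\<omega>. ennreal (g \<omega>)) \<omega> \<le> ennreal (e \<omega>)" .
  qed
  finally have fin: "(\<integral>\<^sup>+\<omega>. ennreal (h \<omega> * g \<omega>) \<partial>M) \<le> (\<integral>\<^sup>+\<omega>. ennreal (e \<omega>) \<partial>M)" .
  also have "\<dots> < \<infinity>" using e by (simp add: nn_integral_eq_integral)
  finally show int: "integrable M (\<lambda>\<omega>. h \<omega> * g \<omega>)"
    using h g by (intro integrableI_nonneg) auto
  show "(\<integral>\<omega>. h \<omega> * g \<omega> \<partial>M) \<le> (\<integral>\<omega>. e \<omega> \<partial>M)"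
    using fin int e h g by (simp add: nn_integral_eq_integral)
qed

section \<open>Convergence of the iteration\<close>

theorem theorem1:
  fixes M :: "'a measure"
    and H :: "real^'n \<Rightarrow> real^'n"
    and x w :: "nat \<Rightarrow> 'a \<Rightarrow> real^'n"
    and \<alpha> :: "nat \<Rightarrow> real"
    and xstar :: "real^'n"
    and \<Phi> :: "real^'n \<Rightarrow> real"
    and gradPhi :: "real^'n \<Rightarrow> real^'n"
    and p \<eta> c1 c2 L2 A B C :: real
  assumes prob: "prob_space M"
    and p_gt: "p > 1"
    (* the iteration, with a deterministic initial point *)
    and x0: "\<exists>x0. \<forall>\<omega>\<in>space M. x 0 \<omega> = x0"
    and iter: "\<And>k \<omega>. \<omega> \<in> space M \<Longrightarrow>
                 x (Suc k) \<omega> = x k \<omega> + \<alpha> k *\<^sub>R (H (x k \<omega>) - x k \<omega> + w k \<omega>)"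
    (* step sizes *)
    and \<alpha>_pos: "\<And>k. \<alpha> k > 0"
    and \<alpha>_noninc: "decseq \<alpha>"
    and \<alpha>_sum_inf: "\<not> summable \<alpha>"
    and \<alpha>_sum_p: "summable (\<lambda>k. \<alpha> k powr p)"
    (* Drift Assumption *)
    and fix_star: "H xstar = xstar"
    and \<Phi>_nonneg: "\<And>y. \<Phi> y \<ge> 0"
    and \<Phi>_grad: "\<And>y. (\<Phi> has_derivative (\<lambda>h. gradPhi y \<bullet> h)) (at y)"
    and \<eta>_pos: "\<eta> > 0" and c1_pos: "c1 > 0" and c2_pos: "c2 > 0" and L2_pos: "L2 > 0"
    and drift: "\<And>y. gradPhi (y - xstar) \<bullet> (H y - y) \<le> - \<eta> * \<Phi> (y - xstar)"
    and smooth: "\<And>y z. \<Phi> z \<le> \<Phi> y + gradPhi y \<bullet> (z - y) + L2 / 2 * (norm (z - y))\<^sup>2"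
    and \<Phi>_lower: "\<And>y. c1 * (norm (y - xstar))\<^sup>2 \<le> \<Phi> (y - xstar)"
    and \<Phi>_upper: "\<And>y. \<Phi> (y - xstar) \<le> c2 * (norm (y - xstar))\<^sup>2"
    (* Unbiased Noise Assumption (componentwise conditional expectation) *)
    and w_int: "\<And>k. integrable M (w k)"
    and w_unbiased: "\<And>k i. AE \<omega> in M.
          real_cond_exp M (natural_filtration M x k) (\<lambda>\<omega>. w k \<omega> $ i) \<omega> = 0"
    (* p-th Moment Noise Assumption *)
    and A_pos: "A > 0" and B_nonneg: "B \<ge> 0"
    and w_moment: "\<And>k. AE \<omega> in M.
          nn_cond_exp M (natural_filtration M x k) (\<lambda>\<omega>. ennreal (norm (w k \<omega>) powr p)) \<omega>
            \<le> ennreal (A + B * norm (x k \<omega> - xstar) powr p)"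
    (* Lipschitz Assumption *)
    and C_pos: "C > 0"
    and lipschitz: "\<And>y z. norm (H y - H z) \<le> C * norm (y - z)"
  shows "(\<forall>y. H y = y \<longleftrightarrow> y = xstar) \<and>
         (AE \<omega> in M. (\<lambda>k. x k \<omega>) \<longlonglongrightarrow> xstar)"
proof (intro conjI allI)
  interpret prob_space M by (rule prob)
  show "H y = y \<longleftrightarrow> y = xstar" for y
  proof
    assume "H y = y"
    then have "\<eta> * \<Phi> (y - xstar) \<le> 0" using drift[of y] by simp
    then have "\<Phi> (y - xstar) \<le> 0" using \<eta>_pos by (simp add: mult_le_0_iff)
    then have "c1 * (norm (y - xstar))\<^sup>2 \<le> 0" using \<Phi>_lower[of y] by linarith
    then show "y = xstar" using c1_pos by (simp add: mult_le_0_iff)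
  qed (use fix_star in simp)

  \<comment> \<open>Regularity of the data and integrability of the iterates\<close>
  have H_cont: "continuous_on UNIV H"
    by (rule lipschitz_on_continuous_on[of C])
      (use lipschitz C_pos in \<open>auto simp: lipschitz_on_def dist_norm\<close>)
  then have H_meas[measurable]: "H \<in> borel_measurable borel" by (rule borel_measurable_continuous_onI)
  have \<Phi>_cont: "continuous_on UNIV \<Phi>"
    using \<Phi>_grad by (intro differentiable_imp_continuous_on)
      (auto simp: differentiable_on_def differentiable_def intro: has_derivative_at_withinI)
  then have \<Phi>_meas[measurable]: "\<Phi> \<in> borel_measurable borel" by (rule borel_measurable_continuous_onI)
  have grad_meas[measurable]: "gradPhi \<in> borel_measurable borel"
    using \<Phi>_grad by (rule borel_measurable_gradient)
  have grad_bound: "(norm (gradPhi y))\<^sup>2 \<le> 2 * L2 * \<Phi> y" for y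
    using \<Phi>_nonneg L2_pos smooth by (rule smooth_nonneg_gradient_bound)
  have w_meas[measurable]: "w k \<in> borel_measurable M" for k using w_int[of k] by measurable

  \<comment> \<open>First moments propagate because H grows at most linearly; they are enough for
    \<open>f\<close>, which is bounded by a linear function of the distance.\<close>
  have x_int: "integrable M (x k)" for k
  proof (induction k)
    case 0
    from x0 obtain z where "\<forall>\<omega>\<in>space M. x 0 \<omega> = z" by blast
    then have "integrable M (x 0) \<longleftrightarrow> integrable M (\<lambda>_. z)" by (intro Bochner_Integration.integrable_cong) auto
    then show ?case by simp
  next
    case (Suc k)
    have [measurable]: "x k \<in> borel_measurable M" using Suc by measurable
    have "integrable M (\<lambda>\<omega>. H (x k \<omega>))"
    proof (rule Bochner_Integration.integrable_bound)
      show "integrable M (\<lambda>\<omega>. C * norm (x k \<omega> - xstar) + norm xstar)" using Suc by simp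
      show "AE \<omega> in M. norm (H (x k \<omega>)) \<le> norm (C * norm (x k \<omega> - xstar) + norm xstar)"
      proof (rule AE_I2)
        fix \<omega>
        have "norm (H (x k \<omega>)) \<le> norm (H (x k \<omega>) - H xstar) + norm (H xstar)"
          using norm_triangle_ineq[of "H (x k \<omega>) - H xstar" "H xstar"] by simp
        then show "norm (H (x k \<omega>)) \<le> norm (C * norm (x k \<omega> - xstar) + norm xstar)"
          using lipschitz[of "x k \<omega>" xstar] fix_star by simp
      qed
    qed measurable
    then have "integrable M (\<lambda>\<omega>. x k \<omega> + \<alpha> k *\<^sub>R (H (x k \<omega>) - x k \<omega> + w k \<omega>))" using Suc w_int by simp
    then show ?case using iter by (subst Bochner_Integration.integrable_cong[OF refl]) auto
  qed
  have x_meas[measurable]: "x k \<in> borel_measurable M" for k using x_int[of k] by measurable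

  define F where "F = natural_filtration M x"
  have sub: "subalgebra M (F k)" for k unfolding F_def by (intro subalgebra_natural_filtration x_meas)
  have F_mono: "sets (F k) \<subseteq> sets (F (Suc k))" for k unfolding F_def by (intro sets_natural_filtration_mono) simp
  have x_F[measurable]: "x k \<in> borel_measurable (F k)" for k unfolding F_def by (intro measurable_natural_filtration) simp

  \<comment> \<open>The Lyapunov process and its gradient\<close>
  define j where "j = nat \<lceil>p\<rceil>"
  \<comment> \<open>With m = Suc j the derivative of s^m is m s^j, free of natural-number
    subtraction.\<close>
  define m where "m = Suc j"
  have p_le: "p \<le> real (Suc j)" unfolding j_def by linarith
  define s where "s k \<omega> = \<Phi> (x k \<omega> - xstar)" for k \<omega>
  define n where "n k \<omega> = norm (x k \<omega> - xstar)" for k \<omega>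
  define f where "f k \<omega> = ln (1 + s k \<omega> ^ m)" for k \<omega>
  define \<tau> where "\<tau> k \<omega> = s k \<omega> ^ m / (1 + s k \<omega> ^ m)" for k \<omega>
  \<comment> \<open>\<open>G k\<close> is the gradient of ln (1 + \<Phi>^m) at the current error,
    and \<open>W k\<close> is the p-th power of the noise in units of 1 + n, whose conditional mean
    is at most A + B.\<close>
  define G where "G k \<omega> = (m * s k \<omega> ^ j / (1 + s k \<omega> ^ m)) *\<^sub>R gradPhi (x k \<omega> - xstar)" for k \<omega>
  define W where "W k \<omega> = norm (w k \<omega>) powr p / (1 + n k \<omega>) powr p" for k \<omega>
  have s0: "s k \<omega> \<ge> 0" and n0: "n k \<omega> \<ge> 0" for k \<omega> by (auto simp: s_def n_def \<Phi>_nonneg)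
  have s1: "1 + s k \<omega> ^ m \<ge> 1" for k \<omega> using s0 by simp
  have f0: "f k \<omega> \<ge> 0" for k \<omega> using s1 by (simp add: f_def)
  have \<tau>_eq: "1 - exp (- f k \<omega>) = \<tau> k \<omega>" for k \<omega>
    using s1[of k \<omega>] by (simp add: f_def \<tau>_def exp_minus field_simps)
  have \<tau>: "0 \<le> \<tau> k \<omega>" "\<tau> k \<omega> \<le> 1" for k \<omega>
    using zero_le_power[OF s0, of k \<omega> m] by (auto simp: \<tau>_def divide_le_eq)
  have n_F[measurable]: "n k \<in> borel_measurable (F k)" and s_F[measurable]: "s k \<in> borel_measurable (F k)" for k
    unfolding n_def s_def by measurable
  have f_F[measurable]: "f k \<in> borel_measurable (F k)" and \<tau>_F[measurable]: "\<tau> k \<in> borel_measurable (F k)"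
    and G_F[measurable]: "G k \<in> borel_measurable (F k)" for k
    unfolding f_def \<tau>_def G_def by measurable
  note toM = measurable_from_subalg[OF sub]
  note [measurable] = toM[OF n_F] toM[OF s_F] toM[OF f_F] toM[OF \<tau>_F] toM[OF G_F]

  have f_int: "integrable M (f k)" for k
  proof (rule Bochner_Integration.integrable_bound)
    show "integrable M (\<lambda>\<omega>. m * (c2 + 2 * n k \<omega>))" unfolding n_def using x_int by simp
    show "AE \<omega> in M. norm (f k \<omega>) \<le> norm (m * (c2 + 2 * n k \<omega>))"
    proof (rule AE_I2)
      fix \<omega>
      have "1 + s k \<omega> ^ m \<le> (1 + s k \<omega>) ^ j + s k \<omega> * (1 + s k \<omega>) ^ j"
        unfolding m_def power_Suc using s0[of k \<omega>]
        by (intro add_mono mult_left_mono power_mono one_le_power) auto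
      then have "1 + s k \<omega> ^ m \<le> (1 + s k \<omega>) ^ m" by (simp add: m_def algebra_simps)
      also have "\<dots> \<le> ((1 + c2) * (1 + n k \<omega>)\<^sup>2) ^ m"
      proof (rule power_mono)
        have "1 + s k \<omega> \<le> 1 + c2 * (n k \<omega>)\<^sup>2" using \<Phi>_upper[of "x k \<omega>"] by (simp add: s_def n_def)
        also have "\<dots> \<le> (1 + c2) * (1 + n k \<omega>)\<^sup>2"
          using c2_pos n0[of k \<omega>] by (simp add: power2_eq_square algebra_simps)
        finally show "1 + s k \<omega> \<le> (1 + c2) * (1 + n k \<omega>)\<^sup>2" .
      qed (use s0[of k \<omega>] in simp)
      finally have "f k \<omega> \<le> ln (((1 + c2) * (1 + n k \<omega>)\<^sup>2) ^ m)"
        unfolding f_def using s1[of k \<omega>] by (intro ln_mono) auto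
      also have "\<dots> = m * (ln (1 + c2) + 2 * ln (1 + n k \<omega>))"
        using c2_pos n0[of k \<omega>] by (simp add: ln_realpow ln_mult)
      also have "\<dots> \<le> m * (c2 + 2 * n k \<omega>)"
        using c2_pos n0[of k \<omega>] ln_add_one_self_le_self[of c2] ln_add_one_self_le_self[of "n k \<omega>"]
        by (intro mult_left_mono add_mono) auto
      finally show "norm (f k \<omega>) \<le> norm (m * (c2 + 2 * n k \<omega>))" using f0[of k \<omega>] by simp
    qed
  qed measurable

  have G_bound: "norm (G k \<omega>) \<le> m * (1 + 2 * L2)" for k \<omega>
  proof -
    define t where "t = 1 + s k \<omega> ^ m"
    have t: "t \<ge> 1" using s1 by (simp add: t_def)
    have sj: "s k \<omega> ^ j \<le> t"
    proof (cases "s k \<omega> \<le> 1")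
      case True
      then show ?thesis using s0[of k \<omega>] t power_le_one[of "s k \<omega>" j] by linarith
    next
      case False
      then have "s k \<omega> ^ j \<le> s k \<omega> ^ m" by (intro power_increasing) (auto simp: m_def)
      then show ?thesis by (simp add: t_def)
    qed
    \<comment> \<open>The gradient norm is of the order of a square root of s, but the cruder linear
      bound 1 + 2 L2 s is enough: s^j times s is s^m, which the denominator still controls.\<close>
    define \<gamma> where "\<gamma> = norm (gradPhi (x k \<omega> - xstar))"
    have "\<gamma> \<ge> 0" by (simp add: \<gamma>_def)
    moreover have "2 * \<gamma> \<le> 1 + \<gamma>\<^sup>2" using sum_squares_ge_zero[of "\<gamma> - 1" 0]
      by (simp add: power2_eq_square algebra_simps)
    ultimately have "\<gamma> \<le> 1 + \<gamma>\<^sup>2" by linarith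
    then have "\<gamma> \<le> 1 + 2 * L2 * s k \<omega>" using grad_bound[of "x k \<omega> - xstar"] by (simp add: \<gamma>_def s_def)
    then have "s k \<omega> ^ j * \<gamma> \<le> s k \<omega> ^ j * (1 + 2 * L2 * s k \<omega>)" using s0[of k \<omega>] by (intro mult_left_mono) auto
    also have "\<dots> = s k \<omega> ^ j + 2 * L2 * s k \<omega> ^ m" by (simp add: m_def algebra_simps)
    also have "\<dots> \<le> t + 2 * L2 * t" using sj L2_pos by (intro add_mono mult_left_mono) (auto simp: t_def)
    finally have "s k \<omega> ^ j * \<gamma> / t \<le> 1 + 2 * L2" using t by (simp add: field_simps)
    then have "m * (s k \<omega> ^ j * \<gamma> / t) \<le> m * (1 + 2 * L2)" by (rule mult_left_mono) simp
    moreover have "norm (G k \<omega>) = m * (s k \<omega> ^ j * \<gamma> / t)"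
      using s0[of k \<omega>] t by (simp add: G_def \<gamma>_def t_def)
    ultimately show ?thesis by simp
  qed

  \<comment> \<open>Constants and the one-step bound along a path\<close>
  define c3 where "c3 = 1 + 2 powr p * (C + 1) powr p"
  \<comment> \<open>From \<xi> = (C + 1) + \<bar>w\<bar> / (1 + n) and the power of a sum bounded by
    twice the maximum, 1 + \<xi>^p \<le> c3 + 2^p W, whose conditional mean is at most \<Xi>. The
    choice of \<epsilon> then makes the remainder consume exactly half of the drift m \<eta>
    \<alpha> \<tau>.\<close>
  define \<Xi> where "\<Xi> = c3 + 2 powr p * (A + B)"
  have c3: "c3 \<ge> 1" by (simp add: c3_def)
  have \<Xi>: "\<Xi> > 0" using A_pos B_nonneg c3 by (auto simp: \<Xi>_def intro!: add_pos_nonneg)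
  define \<epsilon> where "\<epsilon> = m * \<eta> / (2 * \<Xi>)"
  have \<epsilon>: "\<epsilon> > 0" using \<eta>_pos \<Xi> by (simp add: \<epsilon>_def m_def)
  have "\<exists>K\<ge>0. \<exists>a>0. \<forall>(\<alpha>::real) (\<xi>::real) (n::real) (s::real) (t::real) (d::real). 0 < \<alpha> \<longrightarrow> \<alpha> \<le> a \<longrightarrow> 0 < \<xi> \<longrightarrow> 0 \<le> n \<longrightarrow> 0 \<le> t \<longrightarrow>
    c1 * n\<^sup>2 \<le> s \<longrightarrow> t \<le> c2 * (n + \<alpha> * \<xi> * (1 + n))\<^sup>2 \<longrightarrow> d\<^sup>2 \<le> 2 * L2 * s * (\<alpha> * \<xi> * (1 + n))\<^sup>2 \<longrightarrow>
    t \<le> s + d + L2 / 2 * (\<alpha> * \<xi> * (1 + n))\<^sup>2 \<longrightarrow>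
    ln (1 + t ^ m) \<le> ln (1 + s ^ m) + m * s ^ j * d / (1 + s ^ m)
      + (\<epsilon> * \<alpha> * (s ^ m / (1 + s ^ m)) + K * \<alpha> powr p) * (1 + \<xi> powr p)"
    unfolding m_def by (rule ln_power_descent_absorbed[OF c1_pos c2_pos L2_pos p_gt p_le \<epsilon>])
  then obtain K a where K: "K \<ge> 0" and a: "a > 0" and
    pw': "\<forall>(\<alpha>::real) (\<xi>::real) (n::real) (s::real) (t::real) (d::real). 0 < \<alpha> \<longrightarrow> \<alpha> \<le> a \<longrightarrow> 0 < \<xi> \<longrightarrow> 0 \<le> n \<longrightarrow> 0 \<le> t \<longrightarrow>
    c1 * n\<^sup>2 \<le> s \<longrightarrow> t \<le> c2 * (n + \<alpha> * \<xi> * (1 + n))\<^sup>2 \<longrightarrow> d\<^sup>2 \<le> 2 * L2 * s * (\<alpha> * \<xi> * (1 + n))\<^sup>2 \<longrightarrow>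
    t \<le> s + d + L2 / 2 * (\<alpha> * \<xi> * (1 + n))\<^sup>2 \<longrightarrow>
    ln (1 + t ^ m) \<le> ln (1 + s ^ m) + m * s ^ j * d / (1 + s ^ m)
      + (\<epsilon> * \<alpha> * (s ^ m / (1 + s ^ m)) + K * \<alpha> powr p) * (1 + \<xi> powr p)"
    by (elim exE conjE)
  note pw = pw'[rule_format]

  \<comment> \<open>This coefficient of the remainder is \<open>F k\<close>-measurable and bounded,
    so it may enter as a weight in the conditional moment bound.\<close>
  define R where "R k \<omega> = \<epsilon> * \<alpha> k * \<tau> k \<omega> + K * \<alpha> k powr p" for k \<omega>
  have R0: "R k \<omega> \<ge> 0" and R_le: "R k \<omega> \<le> \<epsilon> * \<alpha> k + K * \<alpha> k powr p" for k \<omega>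
    using \<epsilon> K \<alpha>_pos[of k] \<tau>[of k \<omega>] by (auto simp: R_def)
  have R_F[measurable]: "R k \<in> borel_measurable (F k)" for k unfolding R_def by measurable
  note [measurable] = toM[OF R_F]

  have pointwise: "f (Suc k) \<omega> \<le> f k \<omega> - m * \<eta> * \<alpha> k * \<tau> k \<omega> + \<alpha> k * (G k \<omega> \<bullet> w k \<omega>) + R k \<omega> * (c3 + 2 powr p * W k \<omega>)"
    if \<omega>: "\<omega> \<in> space M" and k: "\<alpha> k \<le> a" for k \<omega>
  proof -
    define y where "y = x k \<omega> - xstar"
    define v where "v = H (x k \<omega>) - x k \<omega> + w k \<omega>"
    \<comment> \<open>The summand C + 1 covers H(x) - x relative to 1 + n, and the quotient covers
      the noise; together they give \<bar>v\<bar> \<le> \<xi> (1 + n).\<close>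
    define \<xi> where "\<xi> = (C + 1) + norm (w k \<omega>) / (1 + n k \<omega>)"
    define d where "d = \<alpha> k * (gradPhi y \<bullet> v)"
    have \<xi>: "\<xi> > 0" using C_pos n0[of k \<omega>] by (auto simp: \<xi>_def intro!: add_pos_nonneg divide_nonneg_nonneg)
    have y': "x (Suc k) \<omega> - xstar = y + \<alpha> k *\<^sub>R v" using iter[OF \<omega>] by (simp add: y_def v_def)
    have "norm v \<le> \<xi> * (1 + n k \<omega>)"
    proof -
      have "norm v \<le> norm (H (x k \<omega>) - H xstar) + norm (xstar - x k \<omega>) + norm (w k \<omega>)"
        unfolding v_def using norm_triangle_ineq[of "H (x k \<omega>) - H xstar" "xstar - x k \<omega>"]
          norm_triangle_ineq[of "H (x k \<omega>) - x k \<omega>" "w k \<omega>"] fix_star by simp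
      also have "\<dots> \<le> C * n k \<omega> + n k \<omega> + norm (w k \<omega>)"
        using lipschitz[of "x k \<omega>" xstar] by (simp add: n_def norm_minus_commute)
      also have "\<dots> \<le> (C + 1) * (1 + n k \<omega>) + norm (w k \<omega>)" using C_pos by (simp add: algebra_simps)
      also have "\<dots> = \<xi> * (1 + n k \<omega>)" using n0[of k \<omega>] by (simp add: \<xi>_def field_simps)
      finally show ?thesis .
    qed
    then have u: "norm (\<alpha> k *\<^sub>R v) \<le> \<alpha> k * \<xi> * (1 + n k \<omega>)" using \<alpha>_pos[of k] by simp
    then have u2: "(norm (\<alpha> k *\<^sub>R v))\<^sup>2 \<le> (\<alpha> k * \<xi> * (1 + n k \<omega>))\<^sup>2" by (intro power_mono) auto
    have "ln (1 + s (Suc k) \<omega> ^ m) \<le> ln (1 + s k \<omega> ^ m) + m * s k \<omega> ^ j * d / (1 + s k \<omega> ^ m)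
      + (\<epsilon> * \<alpha> k * (s k \<omega> ^ m / (1 + s k \<omega> ^ m)) + K * \<alpha> k powr p) * (1 + \<xi> powr p)"
    proof (rule pw[OF \<alpha>_pos k \<xi> n0 s0])
      show "c1 * (n k \<omega>)\<^sup>2 \<le> s k \<omega>" using \<Phi>_lower by (simp add: n_def s_def)
      have "norm (x (Suc k) \<omega> - xstar) \<le> n k \<omega> + \<alpha> k * \<xi> * (1 + n k \<omega>)"
        unfolding y' using norm_triangle_ineq[of y "\<alpha> k *\<^sub>R v"] u by (simp add: n_def y_def)
      then have "(norm (x (Suc k) \<omega> - xstar))\<^sup>2 \<le> (n k \<omega> + \<alpha> k * \<xi> * (1 + n k \<omega>))\<^sup>2" by (intro power_mono) auto
      then have "c2 * (norm (x (Suc k) \<omega> - xstar))\<^sup>2 \<le> c2 * (n k \<omega> + \<alpha> k * \<xi> * (1 + n k \<omega>))\<^sup>2"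
        using c2_pos by (intro mult_left_mono) auto
      then show "s (Suc k) \<omega> \<le> c2 * (n k \<omega> + \<alpha> k * \<xi> * (1 + n k \<omega>))\<^sup>2"
        using \<Phi>_upper[of "x (Suc k) \<omega>"] unfolding s_def by linarith
      have "d\<^sup>2 = (gradPhi y \<bullet> (\<alpha> k *\<^sub>R v))\<^sup>2" by (simp add: d_def)
      also have "\<dots> \<le> (norm (gradPhi y))\<^sup>2 * (norm (\<alpha> k *\<^sub>R v))\<^sup>2"
        using Cauchy_Schwarz_ineq[of "gradPhi y" "\<alpha> k *\<^sub>R v"] by (simp only: power2_norm_eq_inner)
      also have "\<dots> \<le> (2 * L2 * s k \<omega>) * (\<alpha> k * \<xi> * (1 + n k \<omega>))\<^sup>2"
        using grad_bound[of y] u2 L2_pos s0 by (intro mult_mono) (auto simp: s_def y_def \<Phi>_nonneg)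
      finally show "d\<^sup>2 \<le> 2 * L2 * s k \<omega> * (\<alpha> k * \<xi> * (1 + n k \<omega>))\<^sup>2" .
      have "s (Suc k) \<omega> \<le> s k \<omega> + d + L2 / 2 * (norm (\<alpha> k *\<^sub>R v))\<^sup>2"
        using smooth[of "y + \<alpha> k *\<^sub>R v" y] unfolding s_def y' by (simp add: y_def d_def)
      also have "\<dots> \<le> s k \<omega> + d + L2 / 2 * (\<alpha> k * \<xi> * (1 + n k \<omega>))\<^sup>2"
        using u2 L2_pos by (intro add_left_mono mult_left_mono) auto
      finally show "s (Suc k) \<omega> \<le> s k \<omega> + d + L2 / 2 * (\<alpha> k * \<xi> * (1 + n k \<omega>))\<^sup>2" .
    qed
    then have 1: "f (Suc k) \<omega> \<le> f k \<omega> + m * s k \<omega> ^ j * d / (1 + s k \<omega> ^ m) + R k \<omega> * (1 + \<xi> powr p)"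
      by (simp only: f_def R_def \<tau>_def)
    have 2: "m * s k \<omega> ^ j * d / (1 + s k \<omega> ^ m) \<le> - (m * \<eta> * \<alpha> k * \<tau> k \<omega>) + \<alpha> k * (G k \<omega> \<bullet> w k \<omega>)"
    proof -
      \<comment> \<open>\<open>r\<close> is the scalar factor of the gradient of ln (1 + \<Phi>^m).
        Since r s = m \<tau>, the drift assumption becomes the decrease in \<tau>, and what remains
        of the linear term is the noise against \<open>G k\<close>.\<close>
      define r where "r = m * s k \<omega> ^ j / (1 + s k \<omega> ^ m)"
      have r: "r \<ge> 0" using s0[of k \<omega>] by (simp add: r_def)
      have "gradPhi y \<bullet> v \<le> - \<eta> * s k \<omega> + gradPhi y \<bullet> w k \<omega>"
        using drift[of "x k \<omega>"] by (simp add: v_def inner_add_right y_def s_def)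
      then have "\<alpha> k * r * (gradPhi y \<bullet> v) \<le> \<alpha> k * r * (- \<eta> * s k \<omega> + gradPhi y \<bullet> w k \<omega>)"
        using r \<alpha>_pos[of k] by (intro mult_left_mono) auto
      moreover have "r * s k \<omega> = m * \<tau> k \<omega>" by (simp add: r_def \<tau>_def m_def)
      moreover have "G k \<omega> \<bullet> w k \<omega> = r * (gradPhi y \<bullet> w k \<omega>)" by (simp add: G_def r_def y_def)
      moreover have "m * s k \<omega> ^ j * d / (1 + s k \<omega> ^ m) = \<alpha> k * r * (gradPhi y \<bullet> v)" by (simp add: d_def r_def)
      moreover have "\<alpha> k * r * (- \<eta> * s k \<omega> + gradPhi y \<bullet> w k \<omega>) = - (\<eta> * \<alpha> k * (r * s k \<omega>)) + \<alpha> k * (r * (gradPhi y \<bullet> w k \<omega>))"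
        by (simp add: algebra_simps)
      ultimately show ?thesis by (simp add: ac_simps)
    qed
    have "1 + \<xi> powr p \<le> c3 + 2 powr p * W k \<omega>"
    proof -
      define b where "b = norm (w k \<omega>) / (1 + n k \<omega>)"
      have b: "b \<ge> 0" using n0[of k \<omega>] by (simp add: b_def)
      have "\<xi> powr p \<le> (2 * max (C + 1) b) powr p"
      proof (rule powr_mono2)
        show "\<xi> \<le> 2 * max (C + 1) b" unfolding \<xi>_def b_def[symmetric] by (simp add: max_def)
      qed (use \<xi> p_gt in auto)
      also have "\<dots> = 2 powr p * max (C + 1) b powr p" using b by (simp add: powr_mult)
      also have "\<dots> \<le> 2 powr p * ((C + 1) powr p + b powr p)" by (intro mult_left_mono) (auto simp: max_def)
      also have "b powr p = W k \<omega>" using n0[of k \<omega>] by (simp add: b_def W_def powr_divide)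
      finally show ?thesis by (simp add: c3_def algebra_simps)
    qed
    from mult_left_mono[OF this R0[of k \<omega>]] 1 2 show ?thesis by linarith
  qed

  \<comment> \<open>The integrated almost supermartingale inequality\<close>
  define b where "b k = \<Xi> * K * \<alpha> k powr p" for k
  have step: "(\<integral>\<omega>. indicator E \<omega> * f (Suc k) \<omega> \<partial>M) \<le> (\<integral>\<omega>. indicator E \<omega> * f k \<omega> \<partial>M)
      - m * \<eta> / 2 * \<alpha> k * (\<integral>\<omega>. indicator E \<omega> * (1 - exp (- f k \<omega>)) \<partial>M) + b k"
    if E: "E \<in> sets (F k)" and k: "\<alpha> k \<le> a" for E k
  proof -
    note [measurable] = E
    have EM[measurable]: "E \<in> sets M" using E sub[of k] by (auto simp: subalgebra_def)
    \<comment> \<open>Restricting \<open>G k\<close> to E keeps it bounded and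
      \<open>F k\<close>-measurable, so the centred noise integrates to zero over every such
      event.\<close>
    have noise: "integrable M (\<lambda>\<omega>. (indicator E \<omega> *\<^sub>R G k \<omega>) \<bullet> w k \<omega>)" "(\<integral>\<omega>. (indicator E \<omega> *\<^sub>R G k \<omega>) \<bullet> w k \<omega> \<partial>M) = 0"
    proof -
      have "norm (indicator E \<omega> *\<^sub>R G k \<omega>) \<le> m * (1 + 2 * L2)" for \<omega>
        using G_bound[of k \<omega>] L2_pos by (simp split: split_indicator)
      from expectation_inner_cond_centered[OF sub w_int w_unbiased[folded F_def] _ this]
      show "integrable M (\<lambda>\<omega>. (indicator E \<omega> *\<^sub>R G k \<omega>) \<bullet> w k \<omega>)" "(\<integral>\<omega>. (indicator E \<omega> *\<^sub>R G k \<omega>) \<bullet> w k \<omega> \<partial>M) = 0"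
        by measurable
    qed
    have R_int: "integrable M (\<lambda>\<omega>. indicator E \<omega> * R k \<omega>)"
      by (rule integrable_const_bound[of _ "\<epsilon> * \<alpha> k + K * \<alpha> k powr p"])
        (use R0 R_le order_trans[OF R0 R_le] in \<open>auto split: split_indicator\<close>)
    have \<tau>_int: "integrable M (\<lambda>\<omega>. indicator E \<omega> * \<tau> k \<omega>)"
      by (rule integrable_const_bound[of _ 1]) (use \<tau> in \<open>auto split: split_indicator\<close>)
    have fE_int: "integrable M (\<lambda>\<omega>. indicator E \<omega> * f i \<omega>)" for i
      using integrable_mult_indicator[OF EM f_int[of i]] by simp
    have moment: "integrable M (\<lambda>\<omega>. indicator E \<omega> * R k \<omega> / (1 + n k \<omega>) powr p * norm (w k \<omega>) powr p)"
      "(\<integral>\<omega>. indicator E \<omega> * R k \<omega> / (1 + n k \<omega>) powr p * norm (w k \<omega>) powr p \<partial>M) \<le> (\<integral>\<omega>. indicator E \<omega> * R k \<omega> * (A + B) \<partial>M)"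
    proof -
      \<comment> \<open>Division by (1 + n)^p cancels the growth of the moment bound, so no p-th
        moment of the iterates enters.\<close>
      have bd: "indicator E \<omega> * R k \<omega> / (1 + n k \<omega>) powr p * (A + B * norm (x k \<omega> - xstar) powr p) \<le> indicator E \<omega> * R k \<omega> * (A + B)" for \<omega>
      proof -
        have q: "(1 + n k \<omega>) powr p \<ge> 1" using n0[of k \<omega>] p_gt by (simp add: ge_one_powr_ge_zero)
        have "n k \<omega> powr p \<le> (1 + n k \<omega>) powr p" using n0[of k \<omega>] p_gt by (intro powr_mono2) auto
        then have "A * 1 + B * n k \<omega> powr p \<le> A * (1 + n k \<omega>) powr p + B * (1 + n k \<omega>) powr p"
          using A_pos B_nonneg q by (intro add_mono mult_left_mono) auto
        then have "(A + B * n k \<omega> powr p) / (1 + n k \<omega>) powr p \<le> A + B"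
          using q A_pos B_nonneg by (simp add: divide_le_eq distrib_right)
        then have "indicator E \<omega> * R k \<omega> * ((A + B * n k \<omega> powr p) / (1 + n k \<omega>) powr p) \<le> indicator E \<omega> * R k \<omega> * (A + B)"
          using R0[of k \<omega>] by (intro mult_left_mono) auto
        then show ?thesis by (simp add: n_def)
      qed
      have e: "integrable M (\<lambda>\<omega>. indicator E \<omega> * R k \<omega> * (A + B))" using R_int by simp
      show "integrable M (\<lambda>\<omega>. indicator E \<omega> * R k \<omega> / (1 + n k \<omega>) powr p * norm (w k \<omega>) powr p)"
        by (rule expectation_le_nn_cond_exp_bound(1)[OF sub _ _ _ _ w_moment[of k, folded F_def] bd e])
          (use R0 A_pos B_nonneg in auto)
      show "(\<integral>\<omega>. indicator E \<omega> * R k \<omega> / (1 + n k \<omega>) powr p * norm (w k \<omega>) powr p \<partial>M) \<le> (\<integral>\<omega>. indicator E \<omega> * R k \<omega> * (A + B) \<partial>M)"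
        by (rule expectation_le_nn_cond_exp_bound(2)[OF sub _ _ _ _ w_moment[of k, folded F_def] bd e])
          (use R0 A_pos B_nonneg in auto)
    qed
    have "indicator E \<omega> * R k \<omega> / (1 + n k \<omega>) powr p * norm (w k \<omega>) powr p = indicator E \<omega> * R k \<omega> * W k \<omega>" for \<omega>
      by (simp add: W_def)
    note moment = moment[unfolded this]
    have "(\<integral>\<omega>. indicator E \<omega> * f (Suc k) \<omega> \<partial>M) \<le> (\<integral>\<omega>. indicator E \<omega> * f k \<omega> - m * \<eta> * \<alpha> k * (indicator E \<omega> * \<tau> k \<omega>)
        + \<alpha> k * ((indicator E \<omega> *\<^sub>R G k \<omega>) \<bullet> w k \<omega>) + (c3 * (indicator E \<omega> * R k \<omega>) + 2 powr p * (indicator E \<omega> * R k \<omega> * W k \<omega>)) \<partial>M)"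
    proof (rule integral_mono)
      fix \<omega> assume "\<omega> \<in> space M"
      from pointwise[OF this k]
      show "indicator E \<omega> * f (Suc k) \<omega> \<le> indicator E \<omega> * f k \<omega> - m * \<eta> * \<alpha> k * (indicator E \<omega> * \<tau> k \<omega>)
        + \<alpha> k * ((indicator E \<omega> *\<^sub>R G k \<omega>) \<bullet> w k \<omega>) + (c3 * (indicator E \<omega> * R k \<omega>) + 2 powr p * (indicator E \<omega> * R k \<omega> * W k \<omega>))"
        by (cases "\<omega> \<in> E") (auto simp: algebra_simps)
    qed (intro fE_int Bochner_Integration.integrable_add Bochner_Integration.integrable_diff
          integrable_mult_right \<tau>_int noise(1) R_int moment(1))+
    also have "\<dots> = (\<integral>\<omega>. indicator E \<omega> * f k \<omega> \<partial>M) - m * \<eta> * \<alpha> k * (\<integral>\<omega>. indicator E \<omega> * \<tau> k \<omega> \<partial>M)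
       + (c3 * (\<integral>\<omega>. indicator E \<omega> * R k \<omega> \<partial>M) + 2 powr p * (\<integral>\<omega>. indicator E \<omega> * R k \<omega> * W k \<omega> \<partial>M))"
      using noise fE_int \<tau>_int R_int moment(1)
      by (simp only: Bochner_Integration.integral_add Bochner_Integration.integral_diff integral_mult_right_zero
        Bochner_Integration.integrable_add Bochner_Integration.integrable_diff integrable_mult_right mult_zero_right add_0_right)
    also have "\<dots> \<le> (\<integral>\<omega>. indicator E \<omega> * f k \<omega> \<partial>M) - m * \<eta> * \<alpha> k * (\<integral>\<omega>. indicator E \<omega> * \<tau> k \<omega> \<partial>M)
       + (c3 * (\<integral>\<omega>. indicator E \<omega> * R k \<omega> \<partial>M) + 2 powr p * (\<integral>\<omega>. indicator E \<omega> * R k \<omega> * (A + B) \<partial>M))"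
      using moment(2) by (intro add_left_mono mult_left_mono) auto
    also have "\<dots> = (\<integral>\<omega>. indicator E \<omega> * f k \<omega> \<partial>M) - m * \<eta> * \<alpha> k * (\<integral>\<omega>. indicator E \<omega> * \<tau> k \<omega> \<partial>M)
       + \<Xi> * (\<integral>\<omega>. indicator E \<omega> * R k \<omega> \<partial>M)"
      unfolding integral_mult_left_zero \<Xi>_def by (simp add: algebra_simps)
    also have "(\<integral>\<omega>. indicator E \<omega> * R k \<omega> \<partial>M) \<le> \<epsilon> * \<alpha> k * (\<integral>\<omega>. indicator E \<omega> * \<tau> k \<omega> \<partial>M) + K * \<alpha> k powr p"
    proof -
      have "(\<integral>\<omega>. indicator E \<omega> * R k \<omega> \<partial>M) \<le> (\<integral>\<omega>. \<epsilon> * \<alpha> k * (indicator E \<omega> * \<tau> k \<omega>) + K * \<alpha> k powr p \<partial>M)"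
        using \<tau>_int K by (intro integral_mono R_int) (auto simp: R_def split: split_indicator)
      also have "\<dots> = \<epsilon> * \<alpha> k * (\<integral>\<omega>. indicator E \<omega> * \<tau> k \<omega> \<partial>M) + K * \<alpha> k powr p"
        using \<tau>_int by (simp add: prob_space)
      finally show ?thesis .
    qed
    finally have "(\<integral>\<omega>. indicator E \<omega> * f (Suc k) \<omega> \<partial>M) \<le> (\<integral>\<omega>. indicator E \<omega> * f k \<omega> \<partial>M) - m * \<eta> * \<alpha> k * (\<integral>\<omega>. indicator E \<omega> * \<tau> k \<omega> \<partial>M)
       + \<Xi> * (\<epsilon> * \<alpha> k * (\<integral>\<omega>. indicator E \<omega> * \<tau> k \<omega> \<partial>M) + K * \<alpha> k powr p)" using \<Xi> by simp
    moreover have "\<Xi> * \<epsilon> = m * \<eta> / 2" using \<Xi> by (simp add: \<epsilon>_def)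
    then have "\<Xi> * (\<epsilon> * \<alpha> k * I + K * \<alpha> k powr p) = m * \<eta> / 2 * \<alpha> k * I + b k" for I
      by (simp add: b_def distrib_left mult.assoc[symmetric])
    note this[of "\<integral>\<omega>. indicator E \<omega> * \<tau> k \<omega> \<partial>M"]
    moreover have "m * \<eta> * \<alpha> k * I = 2 * (m * \<eta> / 2 * \<alpha> k * I)" for I by simp
    note this[of "\<integral>\<omega>. indicator E \<omega> * \<tau> k \<omega> \<partial>M"]
    ultimately show ?thesis unfolding \<tau>_eq by linarith
  qed

  \<comment> \<open>Passage to the limit\<close>
  have "(\<lambda>k. \<alpha> k powr p) \<longlonglongrightarrow> 0" using \<alpha>_sum_p by (rule summable_LIMSEQ_zero)
  moreover have "a powr p > 0" using a by simp
  ultimately have "eventually (\<lambda>k. \<alpha> k powr p < a powr p) sequentially" by (rule order_tendstoD(2))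
  \<comment> \<open>The one-step bound holds only for step sizes up to a. Summability of their p-th
    powers ensures this from k0 on, and a shifted sequence has the same limit.\<close>
  then obtain k0 where "\<And>k. k \<ge> k0 \<Longrightarrow> \<alpha> k powr p < a powr p" by (auto simp: eventually_sequentially)
  then have k0: "\<alpha> (k + k0) \<le> a" for k
    using powr_mono2[of p a "\<alpha> (k + k0)"] a p_gt by (meson le_add2 less_imp_le nle_le not_le order_trans zero_le_one)
  have "AE \<omega> in M. (\<lambda>k. f (k + k0) \<omega>) \<longlonglongrightarrow> 0"
  proof (rule almost_supermartingale_tendsto_zero[where F = "\<lambda>k. F (k + k0)" and \<alpha> = "\<lambda>k. m * \<eta> / 2 * \<alpha> (k + k0)" and b = "\<lambda>k. b (k + k0)"])
    show "\<not> summable (\<lambda>k. m * \<eta> / 2 * \<alpha> (k + k0))"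
      using \<alpha>_sum_inf \<eta>_pos summable_iff_shift[of \<alpha> k0] by (simp add: m_def summable_cmult_iff)
    have "summable b" unfolding b_def using \<alpha>_sum_p by (intro summable_mult)
    then show "summable (\<lambda>k. b (k + k0))" by (simp add: summable_iff_shift)
    show "b (k + k0) \<ge> 0" for k using \<Xi> K by (simp add: b_def)
    show "0 < m * \<eta> / 2 * \<alpha> (k + k0)" for k using \<eta>_pos \<alpha>_pos by (simp add: m_def)
    show "sets (F (k + k0)) \<subseteq> sets (F (Suc k + k0))" for k using F_mono by simp
    show "(\<integral>\<omega>. indicator E \<omega> * f (Suc k + k0) \<omega> \<partial>M) \<le> (\<integral>\<omega>. indicator E \<omega> * f (k + k0) \<omega> \<partial>M)
      - m * \<eta> / 2 * \<alpha> (k + k0) * (\<integral>\<omega>. indicator E \<omega> * (1 - exp (- f (k + k0) \<omega>)) \<partial>M) + b (k + k0)"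
      if "E \<in> sets (F (k + k0))" for E k using step[OF that k0] by simp
  qed (use sub f_F f_int f0 in auto)
  then show "AE \<omega> in M. (\<lambda>k. x k \<omega>) \<longlonglongrightarrow> xstar"
  proof (rule AE_mp, intro AE_I2 impI)
    fix \<omega> assume "(\<lambda>k. f (k + k0) \<omega>) \<longlonglongrightarrow> 0"
    then have "(\<lambda>k. f k \<omega>) \<longlonglongrightarrow> 0" by (rule LIMSEQ_offset)
    \<comment> \<open>Undoing the logarithm and the m-th power returns to \<Phi>, and its quadratic
      lower bound returns to the distance.\<close>
    then have "(\<lambda>k. exp (f k \<omega>) - 1) \<longlonglongrightarrow> exp 0 - 1" by (intro tendsto_intros)
    moreover have "exp (f k \<omega>) - 1 = s k \<omega> ^ m" for k using s1[of k \<omega>] by (simp add: f_def)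
    ultimately have "(\<lambda>k. root m (s k \<omega> ^ m)) \<longlonglongrightarrow> root m 0" by (intro tendsto_real_root) simp
    moreover have "root m (s k \<omega> ^ m) = s k \<omega>" for k using s0 by (intro real_root_power_cancel) (simp add: m_def)
    ultimately have "(\<lambda>k. s k \<omega>) \<longlonglongrightarrow> 0" by simp
    then have "(\<lambda>k. s k \<omega> / c1) \<longlonglongrightarrow> 0" by (simp add: tendsto_divide_zero)
    then have "(\<lambda>k. (n k \<omega>)\<^sup>2) \<longlonglongrightarrow> 0"
      by (rule tendsto_sandwich[OF _ _ tendsto_const, rotated 2])
        (use \<Phi>_lower c1_pos in \<open>auto simp: n_def s_def field_simps\<close>)
    then have "(\<lambda>k. sqrt ((n k \<omega>)\<^sup>2)) \<longlonglongrightarrow> sqrt 0" by (rule tendsto_real_sqrt)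
    then have "(\<lambda>k. norm (x k \<omega> - xstar)) \<longlonglongrightarrow> 0" by (simp add: n_def)
    then show "(\<lambda>k. x k \<omega>) \<longlonglongrightarrow> xstar" by (simp add: tendsto_norm_zero_iff LIM_zero_iff)
  qed
qed

end
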